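(* Let $n\geq 3$, $m\geq 0$, $s\in\{m+2,\dots,2m+3\}$ be integers, let $\varphi\colon \mathcal O_{\mathbb P^s}^{\oplus n+m}\to\mathcal O_{\mathbb P^s}(1)^{\oplus n}$ be a general morphism, and let $S\subset\mathbb P^s$, $\psi\colon S\to\mathbb P^{n-1}$ and $Z\subset G_{n,s,m}=\mathrm{Gr}(2,n)\times\mathrm{Gr}(2,s+1)\times\mathrm{Gr}(n+m-2,n+m)$ be as defined in the context. Let $$\pi_Z\colon Z\hookrightarrow G_{n,s,m}\xrightarrow{\ \mathrm{pr}_{12}\ }\mathrm{Gr}(2,n)\times\mathrm{Gr}(2,s+1)$$ be the composition of the natural inclusion with the projection to the first two factors. (1) If $n>2s-3m-1$, then $\pi_Z$ is injective. (2) A line $\ell\subset S\subset\mathbb P^s$ such that $\psi(\ell)$ is a line in $\mathbb P^{n-1}$ exists if and only if $\pi_Z$ admits an $(n+m-2)$-dimensional linear fibre (i.e. a fibre isomorphic to $\mathbb P^{n+m-2}$).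
   Context: Work over $\mathbb C$. $V_d=\mathbb C^d$, $\mathbb P^s=\mathbb P(V_{s+1})$ is the space of one-dimensional subspaces, and $\mathrm{Gr}(k,d)$ is the Grassmannian of $k$-dimensional subspaces of $V_d$, with tautological rank $k$ subbundle $\mathcal U$. The morphism $\varphi$ is the same as an $n\times(n+m)$ matrix $M$ of linear forms on $V_{s+1}$, with value $M_v\in\mathsf{Mat}_{n,n+m}(\mathbb C)$ at $v\in V_{s+1}$. "General" means for all $M$ in some nonempty Zariski open subset of the space of such matrices. $S=D_{n-1}(\varphi)\subset\mathbb P^s$ is the closed subscheme where $\mathrm{rank}(M_v)\le n-1$ (defined by the maximal minors); in the given range it is smooth of dimension $s-m-1$, and $\mathrm{rank}(M_v)=n-1$ for every $[v]\in S$. For $[v]\in S$, $\alpha_v\in V_n$ is the nonzero vector, unique up to scaling, with $M_v^t\cdot\alpha_v=0$; the morphism $\psi\colon S\to\mathbb P^{n-1}$ is $[v]\mapsto[\alpha_v]$. The trilinear form $\omega(a,u,b)=a^t\cdot M_u\cdot b$ on $V_n\times V_{s+1}\times V_{n+m}$ defines a section of $\mathcal U^\vee\boxtimes\mathcal U^\vee\boxtimes\mathcal U^\vee$ on $G_{n,s,m}$, and $Z$ is its zero scheme: $(\rho_1,\rho_2,\rho_3)\in Z$ if and only if $\omega(a,u,b)=0$ for all $a\in\rho_1,u\in\rho_2,b\in\rho_3$. *)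

theory Defs
  imports "HOL-Analysis.Analysis"
begin

section \<open>Polynomial functions and the Zariski topology of an affine space\<close>

text \<open>An affine space is given by a type together with its set \<open>C\<close> of coordinate functions.\<close>

inductive_set poly_funs :: "('x \<Rightarrow> complex) set \<Rightarrow> ('x \<Rightarrow> complex) set"
  for C :: "('x \<Rightarrow> complex) set" where
  coord: "c \<in> C \<Longrightarrow> c \<in> poly_funs C"
| const: "(\<lambda>_. a) \<in> poly_funs C"
| add: "f \<in> poly_funs C \<Longrightarrow> g \<in> poly_funs C \<Longrightarrow> (\<lambda>x. f x + g x) \<in> poly_funs C"
| mult: "f \<in> poly_funs C \<Longrightarrow> g \<in> poly_funs C \<Longrightarrow> (\<lambda>x. f x * g x) \<in> poly_funs C"

definition zariski_open :: "('x \<Rightarrow> complex) set \<Rightarrow> 'x set \<Rightarrow> bool" where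
  "zariski_open C U \<longleftrightarrow> (\<exists>F \<subseteq> poly_funs C. - U = {x. \<forall>f\<in>F. f x = 0})"


section \<open>Grassmannians\<close>

definition Gr :: "nat \<Rightarrow> (complex^'d) set set" where
  "Gr k = {W. vec.subspace W \<and> vec.dim W = k}"

abbreviation proj_space :: "(complex^'d) set set" where
  "proj_space \<equiv> Gr 1"

definition is_line :: "(complex^'d) set set \<Rightarrow> bool" where
  "is_line L \<longleftrightarrow> (\<exists>W \<in> Gr 2. L = {p \<in> proj_space. p \<subseteq> W})"

text \<open>
  The Grassmannian carries the structure of a variety as the quotient of the open set of frames
  (linearly independent \<open>k\<close>-tuples of vectors) by the general linear group: a set is closed, resp. a
  function is regular, if and only if its pull back to the frames is so. For \<open>k = 1\<close> this is the usual
  description of projective space by homogeneous coordinates. Subsets carry the induced structure.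
  Only the values \<open>A i\<close> with \<open>i < k\<close> of a frame \<open>A\<close> matter; for \<open>W\<close> in \<open>Gr k\<close>, spanning
  implies linear independence.
\<close>

definition frames :: "nat \<Rightarrow> (complex^'d) set \<Rightarrow> (nat \<Rightarrow> complex^'d) set" where
  "frames k W = {A. vec.span (A ` {..<k}) = W}"

definition frame_coords :: "nat \<Rightarrow> ((nat \<Rightarrow> complex^'d) \<Rightarrow> complex) set" where
  "frame_coords k = {(\<lambda>A. A i $ j) | i j. i < k}"

text \<open>\<open>V\<close> is Zariski open in \<open>X\<close>, where \<open>X\<close> is a subset of \<open>Gr k\<close>.\<close>

definition gr_openin :: "nat \<Rightarrow> (complex^'d) set set \<Rightarrow> (complex^'d) set set \<Rightarrow> bool" where
  "gr_openin k X V \<longleftrightarrow> V \<subseteq> X \<and>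
     (\<exists>F \<subseteq> poly_funs (frame_coords k). X - V = {W \<in> X. \<forall>A \<in> frames k W. \<forall>f \<in> F. f A = 0})"

text \<open>
  Regular functions on \<open>V\<close>: locally, on the principal open set where \<open>q\<close> does not vanish, the
  quotient of two polynomials in the entries of the frames.
\<close>

definition gr_regular :: "nat \<Rightarrow> (complex^'d) set set \<Rightarrow> ((complex^'d) set \<Rightarrow> complex) \<Rightarrow> bool" where
  "gr_regular k V f \<longleftrightarrow>
     (\<forall>W \<in> V. \<forall>A \<in> frames k W.
        \<exists>p \<in> poly_funs (frame_coords k). \<exists>q \<in> poly_funs (frame_coords k). q A \<noteq> 0 \<and>
          (\<forall>W' \<in> V. \<forall>A' \<in> frames k W'. q A' \<noteq> 0 \<longrightarrow> f W' = p A' / q A'))"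

text \<open>Morphisms are continuous maps that pull back regular functions to regular functions.\<close>

definition gr_morphism :: "nat \<Rightarrow> nat \<Rightarrow> (complex^'d) set set \<Rightarrow> (complex^'e) set set \<Rightarrow>
    ((complex^'d) set \<Rightarrow> (complex^'e) set) \<Rightarrow> bool" where
  "gr_morphism k l X Y h \<longleftrightarrow> h ` X \<subseteq> Y \<and>
     (\<forall>V. gr_openin l Y V \<longrightarrow> gr_openin k X (X \<inter> h -` V) \<and>
        (\<forall>f. gr_regular l V f \<longrightarrow> gr_regular k (X \<inter> h -` V) (f \<circ> h)))"

definition gr_isomorphic :: "nat \<Rightarrow> nat \<Rightarrow> (complex^'d) set set \<Rightarrow> (complex^'e) set set \<Rightarrow> bool" where
  "gr_isomorphic k l X Y \<longleftrightarrow>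
     (\<exists>h h'. gr_morphism k l X Y h \<and> gr_morphism l k Y X h' \<and>
        (\<forall>x \<in> X. h' (h x) = x) \<and> (\<forall>y \<in> Y. h (h' y) = y))"


section \<open>Matrices of linear forms\<close>

text \<open>
  With \<open>CARD('n) = n\<close>, \<open>CARD('v) = s + 1\<close> and \<open>CARD('c) = n + m\<close>, an element \<open>M\<close> of
  \<open>complex^'v^'c^'n\<close> is an \<open>n\<close> by \<open>n + m\<close> matrix whose entry \<open>M $ i $ j\<close> is (the coefficient
  vector of) a linear form in \<open>s + 1\<close> variables.
\<close>

definition form_matrix_coords :: "(complex^'v^'c^'n \<Rightarrow> complex) set" where
  "form_matrix_coords = {(\<lambda>M. M $ i $ j $ k) | i j k. True}"

definition value_at :: "complex^'v^'c^'n \<Rightarrow> complex^'v \<Rightarrow> complex^'c^'n" where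
  "value_at M u = (\<chi> i j. \<Sum>k\<in>UNIV. M $ i $ j $ k * u $ k)"

definition degeneracy_locus :: "nat \<Rightarrow> complex^'v^'c^'n \<Rightarrow> (complex^'v) set set" where
  "degeneracy_locus r M = {p \<in> proj_space. \<forall>v \<in> p. rank (value_at M v) \<le> r}"

text \<open>
  The image of \<open>[v]\<close> is the unique point \<open>[\<alpha>]\<close> with \<open>M\<^sub>v\<^sup>t \<alpha> = 0\<close>. It is only meaningful if
  \<open>rank M\<^sub>v = n - 1\<close>, which for general \<open>M\<close> holds on the whole degeneracy locus.
\<close>

definition psi :: "complex^'v^'c^'n \<Rightarrow> (complex^'v) set \<Rightarrow> (complex^'n) set" where
  "psi M p = (THE q. q \<in> proj_space \<and> (\<forall>v \<in> p. \<forall>\<alpha> \<in> q. transpose (value_at M v) *v \<alpha> = 0))"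

text \<open>The form \<open>\<omega>(a,u,b) = a\<^sup>t M\<^sub>u b\<close>; it is bilinear in \<open>a\<close> and \<open>b\<close>, without conjugation.\<close>

definition omega :: "complex^'v^'c^'n \<Rightarrow> complex^'n \<Rightarrow> complex^'v \<Rightarrow> complex^'c \<Rightarrow> complex" where
  "omega M a u b = (\<Sum>i\<in>UNIV. a $ i * (value_at M u *v b) $ i)"

definition zero_locus ::
    "complex^'v^'c^'n \<Rightarrow> ((complex^'n) set \<times> (complex^'v) set \<times> (complex^'c) set) set" where
  "zero_locus M = {(\<rho>\<^sub>1, \<rho>\<^sub>2, \<rho>\<^sub>3) \<in> Gr 2 \<times> Gr 2 \<times> Gr (CARD('c) - 2).
     \<forall>a \<in> \<rho>\<^sub>1. \<forall>u \<in> \<rho>\<^sub>2. \<forall>b \<in> \<rho>\<^sub>3. omega M a u b = 0}"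

definition pr12 :: "'x \<times> 'y \<times> 'z \<Rightarrow> 'x \<times> 'y" where
  "pr12 = (\<lambda>(x, y, z). (x, y))"

text \<open>
  The fibre over \<open>y\<close> of the projection \<open>pr12\<close> restricted to the zero locus. It lies in
  \<open>{y} \<times> Gr (n + m - 2)\<close> and is identified with its image in the last factor.
\<close>

definition fibre :: "complex^'v^'c^'n \<Rightarrow> (complex^'n) set \<times> (complex^'v) set \<Rightarrow> (complex^'c) set set"
  where "fibre M y = (snd \<circ> snd) ` {z \<in> zero_locus M. pr12 z = y}"

end

theory Submission
  imports Defs
begin

text \<open>
  Write \<open>F(a, u) = a\<^sup>t M\<^sub>u\<close> for the linear form on \<open>V\<^bsub>n+m\<^esub>\<close> obtained by contracting the
  trilinear form with \<open>a\<close> and \<open>u\<close>. The fibre over \<open>(\<rho>\<^sub>1, \<rho>\<^sub>2)\<close> consists of the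
  \<open>(n+m-2)\<close>-dimensional subspaces on which all \<open>F(a, u)\<close> with \<open>a \<in> \<rho>\<^sub>1\<close> and \<open>u \<in> \<rho>\<^sub>2\<close> vanish, so
  it depends only on the span of these forms. If the span has dimension at least 3, the fibre is empty; if
  the dimension is 2, the fibre is a point; and if it is 1, the fibre is the set of all hyperplanes
  of an \<open>(n+m-1)\<close>-dimensional space, a dual projective space (lemmas \<open>two_points_rank_one\<close>,
  \<open>fibre_rank_one\<close> and \<open>hyperplane_sections_isomorphic_proj_space\<close>).

  Two conditions on \<open>M\<close> suffice, and both hold for general \<open>M\<close> by a count of parameters.
  (a) The rank of \<open>M\<^sub>u\<close> is at least \<open>n - 1\<close> for all \<open>u \<noteq> 0\<close>. A violation is given by a point \<open>[u]\<close>
  and a plane in \<open>V\<^sub>n\<close>, hence by \<open>s + 2(n-2)\<close> parameters, and imposes \<open>2(n+m)\<close> linear conditions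
  on \<open>M\<close>; the latter number is larger exactly if \<open>s < 2m + 4\<close>. (b) No pair \<open>(\<rho>\<^sub>1, \<rho>\<^sub>2)\<close> has forms
  \<open>F(a, u)\<close> with a span of dimension at most 1. A violation is given by \<open>(\<rho>\<^sub>1, \<rho>\<^sub>2)\<close> and a
  hyperplane in \<open>\<rho>\<^sub>1 \<otimes> \<rho>\<^sub>2\<close>, hence by \<open>2(n-2) + 2(s-1) + 3\<close> parameters, and imposes
  \<open>3(n+m)\<close> conditions, which is the larger number if \<open>n > 2s - 3m - 3\<close>.

  A violation occurs only on a proper closed subset for the following reason: the set of
  violating matrices is a finite union of images of polynomial maps with fewer parameters than there are
  matrix entries, and more than \<open>k\<close> polynomials in \<open>k\<close> variables satisfy a nontrivial polynomial
  relation, since there are more monomials of bounded degree in them than in the variables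
  (\<open>algebraic_dependence\<close>, \<open>thin_linear_conditions\<close>).

  Part (1) is immediate from (b), since a fibre with two points forces a span of dimension at most 1.
  For part (2) assume (a). If the forms over \<open>(\<rho>\<^sub>1, \<rho>\<^sub>2)\<close> are multiples of one form \<open>f\<close>, say
  \<open>F(a, u) = l(a, u) f\<close>, then for every \<open>u \<in> \<rho>\<^sub>2\<close> there is \<open>a \<in> \<rho>\<^sub>1\<close> with \<open>l(a, u) = 0\<close> and
  conversely, so \<open>\<psi>\<close> maps the line of \<open>\<rho>\<^sub>2\<close> onto the line of \<open>\<rho>\<^sub>1\<close> (\<open>line_of_rank_one\<close>). Conversely,
  suppose that \<open>\<psi>\<close> maps the line of \<open>\<rho>\<^sub>2\<close> onto that of \<open>\<rho>\<^sub>1\<close>. Points mapped to \<open>a\<close>, \<open>b\<close> and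
  \<open>a + b\<close> for a basis of \<open>\<rho>\<^sub>1\<close> give three independent tensors in the kernel of
  \<open>\<rho>\<^sub>1 \<otimes> \<rho>\<^sub>2 \<rightarrow> V\<^bsub>n+m\<^esub>\<^sup>\<or>\<close>, so the rank is at most 1, and it is not 0 by (a) (\<open>rank_one_of_line\<close>).
\<close>


section \<open>Polynomial functions and algebraic dependence\<close>

text \<open>
  The bound \<open>e\<close> is on the degree in each variable separately, so that the exponents form a box and
  the number of monomials is \<open>(e + 1) ^ card K\<close>.
\<close>

definition monomial_span :: "'k set \<Rightarrow> nat \<Rightarrow> (('k \<Rightarrow> complex) \<Rightarrow> complex) set" where
  "monomial_span K e = {f. \<exists>c. \<forall>y. f y = (\<Sum>\<beta>\<in>PiE K (\<lambda>_. {..e}). c \<beta> * (\<Prod>i\<in>K. y i ^ \<beta> i))}"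

lemma monomial_span_add:
  assumes "f \<in> monomial_span K e" "g \<in> monomial_span K e"
  shows "(\<lambda>y. f y + g y) \<in> monomial_span K e"
proof -
  from assms obtain c d where
    "\<And>y. f y = (\<Sum>\<beta>\<in>PiE K (\<lambda>_. {..e}). c \<beta> * (\<Prod>i\<in>K. y i ^ \<beta> i))"
    "\<And>y. g y = (\<Sum>\<beta>\<in>PiE K (\<lambda>_. {..e}). d \<beta> * (\<Prod>i\<in>K. y i ^ \<beta> i))"
    unfolding monomial_span_def by auto
  then show ?thesis
    unfolding monomial_span_def
    by (auto simp: sum.distrib[symmetric] distrib_right[symmetric] intro!: exI[of _ "\<lambda>\<beta>. c \<beta> + d \<beta>"])
qed

lemma monomial_span_scale:
  assumes "f \<in> monomial_span K e"
  shows "(\<lambda>y. a * f y) \<in> monomial_span K e"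
proof -
  from assms obtain c where
    "\<And>y. f y = (\<Sum>\<beta>\<in>PiE K (\<lambda>_. {..e}). c \<beta> * (\<Prod>i\<in>K. y i ^ \<beta> i))"
    unfolding monomial_span_def by auto
  then show ?thesis
    unfolding monomial_span_def
    by (auto simp: sum_distrib_left mult.assoc intro!: exI[of _ "\<lambda>\<beta>. a * c \<beta>"])
qed

lemma monomial_in_monomial_span:
  assumes "finite K" "\<And>i. i \<in> K \<Longrightarrow> \<beta> i \<le> e"
  shows "(\<lambda>y. \<Prod>i\<in>K. y i ^ \<beta> i) \<in> monomial_span K e"
proof -
  have 1: "restrict \<beta> K \<in> PiE K (\<lambda>_. {..e})" using assms by auto
  have 2: "finite (PiE K (\<lambda>_. {..e}))" using assms by (auto intro: finite_PiE)
  have "(\<Prod>i\<in>K. y i ^ \<beta> i) = (\<Sum>\<gamma>\<in>PiE K (\<lambda>_. {..e}). of_bool (\<gamma> = restrict \<beta> K) * (\<Prod>i\<in>K. y i ^ \<gamma> i))"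
    for y :: "'a \<Rightarrow> complex"
  proof -
    have "(\<Sum>\<gamma>\<in>PiE K (\<lambda>_. {..e}). of_bool (\<gamma> = restrict \<beta> K) * (\<Prod>i\<in>K. y i ^ \<gamma> i))
       = (\<Sum>\<gamma>\<in>PiE K (\<lambda>_. {..e}). if \<gamma> = restrict \<beta> K then \<Prod>i\<in>K. y i ^ \<gamma> i else 0)"
      by (rule sum.cong) auto
    then show ?thesis
      using 1 2 by (simp add: sum.delta)
  qed
  then show ?thesis
    unfolding monomial_span_def by (auto intro!: exI[of _ "\<lambda>\<gamma>. of_bool (\<gamma> = restrict \<beta> K)"])
qed

lemma monomial_span_sum:
  assumes "finite I" "\<And>i. i \<in> I \<Longrightarrow> f i \<in> monomial_span K e"
  shows "(\<lambda>y. \<Sum>i\<in>I. f i y) \<in> monomial_span K e"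
  using assms
proof (induction I rule: finite_induct)
  case empty
  show ?case by (auto simp: monomial_span_def intro!: exI[of _ "\<lambda>_. 0"])
next
  case (insert x F)
  then show ?case by (auto intro: monomial_span_add)
qed

lemma monomial_span_mult:
  assumes "finite K" "f \<in> monomial_span K d" "g \<in> monomial_span K e"
  shows "(\<lambda>y. f y * g y) \<in> monomial_span K (d + e)"
proof -
  from assms obtain a b where
    f: "\<And>y. f y = (\<Sum>\<beta>\<in>PiE K (\<lambda>_. {..d}). a \<beta> * (\<Prod>i\<in>K. y i ^ \<beta> i))" and
    g: "\<And>y. g y = (\<Sum>\<beta>\<in>PiE K (\<lambda>_. {..e}). b \<beta> * (\<Prod>i\<in>K. y i ^ \<beta> i))"
    unfolding monomial_span_def by auto
  have "f y * g y = (\<Sum>\<beta>\<in>PiE K (\<lambda>_. {..d}). \<Sum>\<gamma>\<in>PiE K (\<lambda>_. {..e}).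
      a \<beta> * b \<gamma> * (\<Prod>i\<in>K. y i ^ (\<beta> i + \<gamma> i)))" for y
    unfolding f g sum_product
    by (intro sum.cong refl) (simp add: power_add prod.distrib algebra_simps)
  then have *: "(\<lambda>y. f y * g y) = (\<lambda>y. \<Sum>\<beta>\<in>PiE K (\<lambda>_. {..d}). \<Sum>\<gamma>\<in>PiE K (\<lambda>_. {..e}).
      a \<beta> * b \<gamma> * (\<Prod>i\<in>K. y i ^ (\<beta> i + \<gamma> i)))" by auto
  show ?thesis
    unfolding *
    by (intro monomial_span_sum monomial_span_scale monomial_in_monomial_span add_mono
          finite_PiE assms(1)) auto
qed

lemma monomial_span_mono:
  assumes "finite K" "f \<in> monomial_span K d" "d \<le> e"
  shows "f \<in> monomial_span K e"
proof -
  have "(\<lambda>y. 1) \<in> monomial_span K (e - d)"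
    using monomial_in_monomial_span[OF assms(1), of "\<lambda>_. 0"] by simp
  from monomial_span_mult[OF assms(1,2) this] assms(3) show ?thesis by simp
qed

lemma monomial_span_prod_power:
  assumes "finite K" "finite I" "\<And>i. i \<in> I \<Longrightarrow> f i \<in> monomial_span K e" "\<And>i. i \<in> I \<Longrightarrow> \<alpha> i \<le> d"
  shows "(\<lambda>y. \<Prod>i\<in>I. f i y ^ \<alpha> i) \<in> monomial_span K (e * d * card I)"
  using assms(2-)
proof (induction I rule: finite_induct)
  case empty
  show ?case using monomial_in_monomial_span[OF assms(1), of "\<lambda>_. 0"] by simp
next
  case (insert x F)
  have pow: "(\<lambda>y. f x y ^ k) \<in> monomial_span K (e * k)" for k
  proof (induction k)
    case 0
    show ?case using monomial_in_monomial_span[OF assms(1), of "\<lambda>_. 0"] by simp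
  next
    case (Suc k)
    from monomial_span_mult[OF assms(1) insert.prems(1)[of x] this] show ?case by simp
  qed
  have "(\<lambda>y. f x y ^ \<alpha> x) \<in> monomial_span K (e * d)"
    by (rule monomial_span_mono[OF assms(1) pow]) (simp add: insert.prems(2))
  from monomial_span_mult[OF assms(1) this insert.IH] insert show ?case
    by (simp add: algebra_simps)
qed

lemma poly_funs_monomial_span:
  assumes "finite K" "f \<in> poly_funs {(\<lambda>y. y i) | i. i \<in> K}"
  shows "\<exists>e. f \<in> monomial_span K e"
  using assms(2)
proof (induction rule: poly_funs.induct)
    case (coord c)
    then obtain i where i: "i \<in> K" "c = (\<lambda>y. y i)" by auto
    have "(\<Prod>j\<in>K. y j ^ of_bool (j = i)) = y i" for y :: "'a \<Rightarrow> complex"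
    proof -
      have "(\<Prod>j\<in>K. y j ^ of_bool (j = i)) = (\<Prod>j\<in>K. if j = i then y j else 1)"
        by (rule prod.cong) auto
      then show ?thesis using i assms(1) by (simp add: prod.delta)
    qed
    then have "(\<lambda>y. y i) \<in> monomial_span K 1"
      using monomial_in_monomial_span[OF assms(1), of "\<lambda>j. of_bool (j = i)" 1] by simp
    then show ?case using i by auto
  next
    case (const a)
    show ?case
      using monomial_span_scale[OF monomial_in_monomial_span[OF assms(1), of "\<lambda>_. 0" 0], of a] by auto
  next
    case (add f g)
    then obtain d e where "f \<in> monomial_span K d" "g \<in> monomial_span K e" by auto
    then have "f \<in> monomial_span K (max d e)" "g \<in> monomial_span K (max d e)"
      by (auto intro: monomial_span_mono[OF assms(1)])
    then show ?case using monomial_span_add by blast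
  next
    case (mult f g)
    then show ?case using monomial_span_mult[OF assms(1)] by blast
qed

text \<open>
  Gaussian elimination: solve one equation for one unknown and induct on the number of equations.
\<close>

lemma nontrivial_solution:
  fixes a :: "'i \<Rightarrow> 'j \<Rightarrow> 'f::field"
  assumes "finite J" "finite I" "card J < card I"
  shows "\<exists>c. (\<exists>i\<in>I. c i \<noteq> 0) \<and> (\<forall>j\<in>J. (\<Sum>i\<in>I. c i * a i j) = 0)"
  using assms
proof (induction J arbitrary: I a rule: finite_induct)
  case empty
  then have "I \<noteq> {}" by auto
  then show ?case by (auto intro!: exI[of _ "\<lambda>_. 1"])
next
  case (insert j J)
  show ?case
  proof (cases "\<forall>i\<in>I. a i j = 0")
    case True
    obtain c where "\<exists>i\<in>I. c i \<noteq> 0" "\<forall>j\<in>J. (\<Sum>i\<in>I. c i * a i j) = 0"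
      using insert.IH[of I a] insert.prems insert.hyps by auto
    moreover have "(\<Sum>i\<in>I. c i * a i j) = 0" using True by simp
    ultimately show ?thesis by blast
  next
    case False
    then obtain k where k: "k \<in> I" "a k j \<noteq> 0" by auto
    have "card J < card (I - {k})" using insert.prems insert.hyps k by auto
    \<comment> \<open>Equation \<open>j\<close> is solved for the unknown \<open>k\<close> and substituted in the others.\<close>
    then have "\<exists>c. (\<exists>i\<in>I - {k}. c i \<noteq> 0) \<and>
        (\<forall>l\<in>J. (\<Sum>i\<in>I - {k}. c i * (a i l - a i j / a k j * a k l)) = 0)"
      using insert.IH[of "I - {k}" "\<lambda>i l. a i l - a i j / a k j * a k l"] insert.prems(1) finite_Diff
      by blast
    then obtain c where c: "\<exists>i\<in>I - {k}. c i \<noteq> 0"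
      and eq: "\<And>l. l \<in> J \<Longrightarrow> (\<Sum>i\<in>I - {k}. c i * (a i l - a i j / a k j * a k l)) = 0"
      by blast
    define s where "s = (\<Sum>i\<in>I - {k}. c i * a i j)"
    define c' where "c' = c(k := - s / a k j)"
    have split: "(\<Sum>i\<in>I. c' i * a i l) = - s / a k j * a k l + (\<Sum>i\<in>I - {k}. c i * a i l)" for l
      using sum.remove[OF insert.prems(1) k(1), of "\<lambda>i. c' i * a i l"]
      by (auto simp: c'_def intro!: sum.cong)
    have "(\<Sum>i\<in>I. c' i * a i l) = 0" if "l \<in> insert j J" for l
    proof (cases "l = j")
      case True
      then show ?thesis using k by (simp add: split s_def)
    next
      case False
      then have "0 = (\<Sum>i\<in>I - {k}. c i * a i l - c i * a i j * (a k l / a k j))"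
        using eq[of l] that by (simp add: algebra_simps)
      also have "\<dots> = (\<Sum>i\<in>I - {k}. c i * a i l) - s * (a k l / a k j)"
        by (simp add: sum_subtractf s_def sum_distrib_right sum_divide_distrib)
      finally show ?thesis by (simp add: split)
    qed
    moreover have "\<exists>i\<in>I. c' i \<noteq> 0" using c by (auto simp: c'_def)
    ultimately show ?thesis by blast
  qed
qed

text \<open>
  Consider the monomials in the \<open>f i\<close> with exponents at most \<open>d\<close>. There are
  \<open>(d + 1) ^ card I\<close> of them, but they lie in the span of only \<open>O(d ^ card K)\<close> monomials in the
  variables, so for large \<open>d\<close> they are linearly dependent.
\<close>

lemma algebraic_dependence:
  fixes f :: "'i \<Rightarrow> ('k \<Rightarrow> complex) \<Rightarrow> complex"
  assumes "finite K" "finite I" "card K < card I"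
    and "\<And>i. i \<in> I \<Longrightarrow> f i \<in> poly_funs {(\<lambda>y. y k) | k. k \<in> K}"
  shows "\<exists>d c. (\<exists>\<alpha>\<in>PiE I (\<lambda>_. {..d::nat}). c \<alpha> \<noteq> 0) \<and>
    (\<forall>y. (\<Sum>\<alpha>\<in>PiE I (\<lambda>_. {..d}). c \<alpha> * (\<Prod>i\<in>I. f i y ^ \<alpha> i)) = 0)"
proof -
  have "\<forall>i\<in>I. \<exists>e. f i \<in> monomial_span K e"
    using assms(4) poly_funs_monomial_span[OF assms(1)] by blast
  then obtain \<epsilon> where \<epsilon>: "\<And>i. i \<in> I \<Longrightarrow> f i \<in> monomial_span K (\<epsilon> i)" by metis
  define e where "e = Max (\<epsilon> ` I)"
  have e: "f i \<in> monomial_span K e" if "i \<in> I" for i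
    using that by (auto intro!: monomial_span_mono[OF assms(1) \<epsilon>] Max_ge simp: e_def assms)
  \<comment> \<open>This choice of \<open>d\<close> gives \<open>(e d card I + 1) ^ card K \<le> (q (d + 1)) ^ card K = d (d + 1) ^ card K\<close>.\<close>
  define q where "q = e * card I + 1"
  define d where "d = q ^ card K"
  define E where "E = e * d * card I"
  define A where "A = PiE I (\<lambda>_. {..d})"
  define B where "B = PiE K (\<lambda>_. {..E})"
  have fin: "finite A" "finite B" using assms by (auto simp: A_def B_def intro: finite_PiE)
  have "card B = (E + 1) ^ card K"
    using assms by (simp add: B_def card_PiE)
  also have "\<dots> \<le> (q * (d + 1)) ^ card K"
    by (intro power_mono) (auto simp: E_def q_def algebra_simps)
  also have "\<dots> = d * (d + 1) ^ card K" unfolding power_mult_distrib by (simp add: d_def)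
  also have "\<dots> < (d + 1) ^ Suc (card K)" by simp
  also have "\<dots> \<le> (d + 1) ^ card I" using assms by (intro power_increasing) auto
  also have "\<dots> = card A" using assms by (simp add: A_def card_PiE)
  finally have less: "card B < card A" .
  have "\<forall>\<alpha>\<in>A. \<exists>a. \<forall>y. (\<Prod>i\<in>I. f i y ^ \<alpha> i) = (\<Sum>\<beta>\<in>B. a \<beta> * (\<Prod>k\<in>K. y k ^ \<beta> k))"
  proof
    fix \<alpha> assume "\<alpha> \<in> A"
    then have "\<And>i. i \<in> I \<Longrightarrow> \<alpha> i \<le> d" by (auto simp: A_def PiE_iff)
    from monomial_span_prod_power[OF assms(1,2) e this]
    show "\<exists>a. \<forall>y. (\<Prod>i\<in>I. f i y ^ \<alpha> i) = (\<Sum>\<beta>\<in>B. a \<beta> * (\<Prod>k\<in>K. y k ^ \<beta> k))"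
      by (auto simp: monomial_span_def B_def E_def)
  qed
  then obtain a where a: "\<And>\<alpha> y. \<alpha> \<in> A \<Longrightarrow>
      (\<Prod>i\<in>I. f i y ^ \<alpha> i) = (\<Sum>\<beta>\<in>B. a \<alpha> \<beta> * (\<Prod>k\<in>K. y k ^ \<beta> k))"
    by metis
  obtain c where c: "\<exists>\<alpha>\<in>A. c \<alpha> \<noteq> 0" "\<And>\<beta>. \<beta> \<in> B \<Longrightarrow> (\<Sum>\<alpha>\<in>A. c \<alpha> * a \<alpha> \<beta>) = 0"
    using nontrivial_solution[OF fin(2,1) less, of a] by auto
  have "(\<Sum>\<alpha>\<in>A. c \<alpha> * (\<Prod>i\<in>I. f i y ^ \<alpha> i)) = 0" for y
  proof -
    have "(\<Sum>\<alpha>\<in>A. c \<alpha> * (\<Prod>i\<in>I. f i y ^ \<alpha> i))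
        = (\<Sum>\<alpha>\<in>A. \<Sum>\<beta>\<in>B. c \<alpha> * a \<alpha> \<beta> * (\<Prod>k\<in>K. y k ^ \<beta> k))"
      by (intro sum.cong refl) (simp add: a sum_distrib_left mult.assoc)
    also have "\<dots> = (\<Sum>\<beta>\<in>B. (\<Sum>\<alpha>\<in>A. c \<alpha> * a \<alpha> \<beta>) * (\<Prod>k\<in>K. y k ^ \<beta> k))"
      by (subst sum.swap) (simp add: sum_distrib_right)
    also have "\<dots> = 0" by (simp add: c)
    finally show ?thesis .
  qed
  with c(1) show ?thesis unfolding A_def by blast
qed

text \<open>
  Together with the previous lemma this turns a linear relation with nonzero coefficients into a
  polynomial that does not vanish identically. The proof splits off one variable and uses that a univariate
  polynomial with infinitely many zeros is zero.
\<close>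

lemma polynomial_zero_function:
  fixes c :: "('i \<Rightarrow> nat) \<Rightarrow> complex"
  assumes "finite I"
    and "\<And>x :: 'i \<Rightarrow> complex. (\<Sum>\<alpha>\<in>PiE I (\<lambda>_. {..d}). c \<alpha> * (\<Prod>i\<in>I. x i ^ \<alpha> i)) = 0"
    and "\<alpha> \<in> PiE I (\<lambda>_. {..d})"
  shows "c \<alpha> = 0"
  using assms
proof (induction I arbitrary: c \<alpha> rule: finite_induct)
  case empty
  then show ?case by simp
next
  case (insert k I)
  let ?P = "PiE I (\<lambda>_. {..d})"
  have inner: "(\<Sum>\<beta>\<in>?P. c (\<beta>(k := j)) * (\<Prod>i\<in>I. x i ^ \<beta> i)) = 0" if "j \<le> d" for j x
  proof -
    define b where "b = (\<lambda>j. \<Sum>\<beta>\<in>?P. c (\<beta>(k := j)) * (\<Prod>i\<in>I. x i ^ \<beta> i))"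
    have inj: "inj_on (\<lambda>(j, \<beta>). \<beta>(k := j)) ({..d} \<times> ?P)"
      using FuncSet.inj_combinator[OF insert.hyps(2), where T = "\<lambda>_. {..d}"] by simp
    have "(\<Sum>j\<le>d. b j * z ^ j) = 0" for z
    proof -
      have "0 = (\<Sum>\<alpha>\<in>PiE (insert k I) (\<lambda>_. {..d}). c \<alpha> * (\<Prod>i\<in>insert k I. (x(k := z)) i ^ \<alpha> i))"
        by (rule insert.prems(1)[symmetric])
      also have "\<dots> = (\<Sum>(j, \<beta>)\<in>{..d} \<times> ?P.
          c (\<beta>(k := j)) * (\<Prod>i\<in>insert k I. (x(k := z)) i ^ (\<beta>(k := j)) i))"
        unfolding PiE_insert_eq
        by (subst sum.reindex[OF inj]) (simp add: case_prod_unfold)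
      also have "\<dots> = (\<Sum>(j, \<beta>)\<in>{..d} \<times> ?P. c (\<beta>(k := j)) * (\<Prod>i\<in>I. x i ^ \<beta> i) * z ^ j)"
      proof (intro sum.cong refl, clarify)
        fix j \<beta>
        have "(\<Prod>i\<in>I. (x(k := z)) i ^ (\<beta>(k := j)) i) = (\<Prod>i\<in>I. x i ^ \<beta> i)"
          using insert.hyps by (intro prod.cong) auto
        then show "c (\<beta>(k := j)) * (\<Prod>i\<in>insert k I. (x(k := z)) i ^ (\<beta>(k := j)) i)
            = c (\<beta>(k := j)) * (\<Prod>i\<in>I. x i ^ \<beta> i) * z ^ j"
          using insert.hyps by simp
      qed
      also have "\<dots> = (\<Sum>j\<le>d. b j * z ^ j)"
        by (simp add: sum.cartesian_product[symmetric] b_def sum_distrib_right)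
      finally show ?thesis by simp
    qed
    then have "\<forall>j\<le>d. b j = 0" using polyfun_eq_0[of b d] by blast
    then show ?thesis using that by (simp add: b_def)
  qed
  obtain j \<beta> where j: "j \<le> d" "\<beta> \<in> ?P" "\<alpha> = \<beta>(k := j)"
    using insert.prems(2) unfolding PiE_insert_eq by auto
  show ?case
    unfolding j(3) by (rule insert.IH[of "\<lambda>\<beta>. c (\<beta>(k := j))", OF inner[OF j(1)] j(2)])
qed

lemma poly_funs_sum:
  assumes "finite I" "\<And>i. i \<in> I \<Longrightarrow> f i \<in> poly_funs C"
  shows "(\<lambda>x. \<Sum>i\<in>I. f i x) \<in> poly_funs C"
  using assms by (induction I rule: finite_induct) (simp_all add: poly_funs.const poly_funs.add)

lemma poly_funs_prod:
  assumes "finite I" "\<And>i. i \<in> I \<Longrightarrow> f i \<in> poly_funs C"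
  shows "(\<lambda>x. \<Prod>i\<in>I. f i x) \<in> poly_funs C"
  using assms by (induction I rule: finite_induct) (simp_all add: poly_funs.const poly_funs.mult)

lemma poly_funs_power: "f \<in> poly_funs C \<Longrightarrow> (\<lambda>x. f x ^ k) \<in> poly_funs C"
  by (induction k) (simp_all add: poly_funs.const poly_funs.mult)

lemma poly_funs_uminus: "f \<in> poly_funs C \<Longrightarrow> (\<lambda>x. - f x) \<in> poly_funs C"
  using poly_funs.mult[OF poly_funs.const[of "-1"]] by fastforce

lemma poly_funs_diff: "f \<in> poly_funs C \<Longrightarrow> g \<in> poly_funs C \<Longrightarrow> (\<lambda>x. f x - g x) \<in> poly_funs C"
  using poly_funs.add[OF _ poly_funs_uminus] by fastforce

lemma poly_funs_compose:
  assumes "f \<in> poly_funs C" "\<And>c. c \<in> C \<Longrightarrow> (\<lambda>x. c (\<phi> x)) \<in> poly_funs D"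
  shows "(\<lambda>x. f (\<phi> x)) \<in> poly_funs D"
  using assms(1)
  by (induction rule: poly_funs.induct) (simp_all add: assms(2) poly_funs.const poly_funs.add poly_funs.mult)

section \<open>Sets avoided by a general matrix\<close>

text \<open>
  A set is thin if it lies in a proper Zariski closed subset. For irreducible affine spaces, such as the
  space of matrices, thin sets form an ideal, and a general point is one outside a given thin set.
\<close>

definition thin :: "('x \<Rightarrow> complex) set \<Rightarrow> 'x set \<Rightarrow> bool" where
  "thin C B \<longleftrightarrow> (\<exists>F\<in>poly_funs C. (\<exists>x. F x \<noteq> 0) \<and> (\<forall>x\<in>B. F x = 0))"

lemma thin_subset: "thin C B \<Longrightarrow> A \<subseteq> B \<Longrightarrow> thin C A"
  unfolding thin_def by blast

text \<open>
  The substitute for the fact that the image of a map from a space of smaller dimension is not dense: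
  by algebraic dependence some nonzero polynomial vanishes on the image. The assumption \<open>surj\<close> says
  that the coordinates \<open>c i\<close> can be prescribed freely.
\<close>

lemma thin_image:
  fixes c :: "'i \<Rightarrow> 'x \<Rightarrow> complex" and \<phi> :: "('k \<Rightarrow> complex) \<Rightarrow> 'x"
  assumes "finite K" "finite I" "card K < card I"
    and \<phi>: "\<And>i. i \<in> I \<Longrightarrow> (\<lambda>y. c i (\<phi> y)) \<in> poly_funs {(\<lambda>y. y k) | k. k \<in> K}"
    and surj: "\<And>t :: 'i \<Rightarrow> complex. \<exists>x. \<forall>i\<in>I. c i x = t i"
  shows "thin (c ` I) (range \<phi>)"
proof -
  have "\<exists>d a. (\<exists>\<alpha>\<in>PiE I (\<lambda>_. {..d::nat}). a \<alpha> \<noteq> 0) \<and>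
    (\<forall>y. (\<Sum>\<alpha>\<in>PiE I (\<lambda>_. {..d}). a \<alpha> * (\<Prod>i\<in>I. c i (\<phi> y) ^ \<alpha> i)) = 0)"
    by (rule algebraic_dependence[OF assms(1-3), of "\<lambda>i y. c i (\<phi> y)"]) (rule \<phi>)
  then obtain d a where a: "\<exists>\<alpha>\<in>PiE I (\<lambda>_. {..d::nat}). a \<alpha> \<noteq> 0"
    "\<And>y. (\<Sum>\<alpha>\<in>PiE I (\<lambda>_. {..d}). a \<alpha> * (\<Prod>i\<in>I. c i (\<phi> y) ^ \<alpha> i)) = 0"
    by blast
  define F where "F = (\<lambda>x. \<Sum>\<alpha>\<in>PiE I (\<lambda>_. {..d}). a \<alpha> * (\<Prod>i\<in>I. c i x ^ \<alpha> i))"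
  have "F \<in> poly_funs (c ` I)"
    unfolding F_def using assms(2)
    by (intro poly_funs_sum poly_funs.mult poly_funs.const poly_funs_prod poly_funs_power
          poly_funs.coord finite_PiE) auto
  moreover have "\<exists>x. F x \<noteq> 0"
  proof (rule ccontr)
    assume none: "\<nexists>x. F x \<noteq> 0"
    have "(\<Sum>\<alpha>\<in>PiE I (\<lambda>_. {..d}). a \<alpha> * (\<Prod>i\<in>I. t i ^ \<alpha> i)) = 0" for t
    proof -
      obtain x where "\<forall>i\<in>I. c i x = t i" using surj by blast
      then have "(\<Prod>i\<in>I. t i ^ \<alpha> i) = (\<Prod>i\<in>I. c i x ^ \<alpha> i)" for \<alpha> :: "'i \<Rightarrow> nat"
        by (intro prod.cong) auto
      then show ?thesis using none by (simp add: F_def)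
    qed
    with polynomial_zero_function[OF assms(2)] a(1) show False by blast
  qed
  ultimately show ?thesis using a(2) by (auto simp: thin_def F_def)
qed

text \<open>
  Restriction to the line through two matrices reduces the absence of zero divisors among polynomial
  functions to that for univariate polynomials.
\<close>

definition affine_line :: "complex^'v^'c^'n \<Rightarrow> complex^'v^'c^'n \<Rightarrow> complex \<Rightarrow> complex^'v^'c^'n" where
  "affine_line M N t = (\<chi> i j k. (1 - t) * M $ i $ j $ k + t * N $ i $ j $ k)"

lemma poly_funs_on_line:
  assumes "F \<in> poly_funs form_matrix_coords"
  shows "\<exists>p. \<forall>t. F (affine_line M N t) = poly p t"
  using assms
proof (induction rule: poly_funs.induct)
  case (coord c)
  then obtain i j k where c: "c = (\<lambda>M. M $ i $ j $ k)" by (auto simp: form_matrix_coords_def)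
  have "c (affine_line M N t) = poly [:M $ i $ j $ k, N $ i $ j $ k - M $ i $ j $ k:] t" for t
    by (simp add: c affine_line_def algebra_simps)
  then show ?case by blast
next
  case (const a)
  have "a = poly [:a:] t" for t by simp
  then show ?case by blast
next
  case (add f g)
  then show ?case by (metis poly_add)
next
  case (mult f g)
  then show ?case by (metis poly_mult)
qed

lemma thin_Un:
  fixes A B :: "(complex^'v^'c^'n) set"
  assumes "thin form_matrix_coords A" "thin form_matrix_coords B"
  shows "thin form_matrix_coords (A \<union> B)"
proof -
  from assms obtain F G M N where
    F: "F \<in> poly_funs form_matrix_coords" "F M \<noteq> 0" "\<forall>x\<in>A. F x = 0" and
    G: "G \<in> poly_funs form_matrix_coords" "G N \<noteq> 0" "\<forall>x\<in>B. G x = 0"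
    unfolding thin_def by blast
  have ends: "affine_line M N 0 = M" "affine_line M N 1 = N"
    by (simp_all add: affine_line_def vec_eq_iff)
  obtain p q where pq: "\<And>t. F (affine_line M N t) = poly p t" "\<And>t. G (affine_line M N t) = poly q t"
    using poly_funs_on_line F(1) G(1) by metis
  then have "p \<noteq> 0" "q \<noteq> 0" using F(2) G(2) ends by (metis poly_0)+
  then have "p * q \<noteq> 0" by simp
  then obtain t where "poly (p * q) t \<noteq> 0" using poly_all_0_iff_0 by blast
  then have "F (affine_line M N t) * G (affine_line M N t) \<noteq> 0" by (simp add: pq)
  with poly_funs.mult[OF F(1) G(1)] F(3) G(3) show ?thesis
    unfolding thin_def by (intro bexI[of _ "\<lambda>x. F x * G x"]) auto
qed

lemma thin_UN:
  fixes A :: "'i \<Rightarrow> (complex^'v^'c^'n) set"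
  assumes "finite I" "\<And>i. i \<in> I \<Longrightarrow> thin form_matrix_coords (A i)"
  shows "thin form_matrix_coords (\<Union>i\<in>I. A i)"
  using assms
proof (induction I rule: finite_induct)
  case empty
  have "(\<lambda>_. 1) \<in> poly_funs (form_matrix_coords :: (complex^'v^'c^'n \<Rightarrow> complex) set)"
    by (rule poly_funs.const)
  then show ?case unfolding thin_def by (intro bexI[of _ "\<lambda>_. 1"]) simp_all
next
  case (insert x F)
  then show ?case by (simp add: thin_Un)
qed

lemma thin_avoided_by_open:
  assumes "thin C B"
  shows "\<exists>U. zariski_open C U \<and> U \<noteq> {} \<and> U \<inter> B = {}"
proof -
  from assms obtain F where F: "F \<in> poly_funs C" "\<exists>x. F x \<noteq> 0" "\<forall>x\<in>B. F x = 0"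
    unfolding thin_def by blast
  have "zariski_open C {x. F x \<noteq> 0}"
    unfolding zariski_open_def using F(1) by (intro exI[of _ "{F}"]) auto
  with F(2,3) show ?thesis by (intro exI[of _ "{x. F x \<noteq> 0}"]) auto
qed

lemma poly_funs_coord: "k \<in> K \<Longrightarrow> (\<lambda>y. y k) \<in> poly_funs {(\<lambda>y. y k) | k. k \<in> K}"
  by (rule poly_funs.coord) blast

lemma card_Compl_add: "card (- A) + card A = CARD('a)" for A :: "'a::finite set"
  using card_Un_disjoint[of "- A" A] by (simp add: Un_commute)

text \<open>
  The parameter count. The vector \<open>y\<close> with entries in \<open>K\<close> is a parameter, and each \<open>r \<in> R\<close> gives
  a tensor \<open>\<tau> r y\<close> in \<open>V\<^sub>n \<otimes> V\<^bsub>s+1\<^esub>\<close> on which \<open>M\<close> is required to vanish; this is one linear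
  equation for each of the \<open>n + m\<close> columns of \<open>M\<close>. Since the tensors are in echelon form with fixed
  pivots, the equations can be solved for the entries at the pivots with polynomial coefficients. Hence
  the matrices that satisfy them for some \<open>y\<close> are the image of a polynomial map from
  \<open>card K + dim - card R (n + m)\<close> parameters, where \<open>dim\<close> is the number of entries of \<open>M\<close>.
\<close>

lemma thin_linear_conditions:
  fixes \<tau> :: "'r \<Rightarrow> ('k \<Rightarrow> complex) \<Rightarrow> 'n::finite \<times> 'v::finite \<Rightarrow> complex"
    and piv :: "'r \<Rightarrow> 'n \<times> 'v"
  assumes "finite K" "finite R" "card K < CARD('c::finite) * card R"
    and poly: "\<And>r e. r \<in> R \<Longrightarrow> (\<lambda>y. \<tau> r y e) \<in> poly_funs {(\<lambda>y. y k) | k. k \<in> K}"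
    and piv: "\<And>r r' y. r \<in> R \<Longrightarrow> r' \<in> R \<Longrightarrow> \<tau> r y (piv r') = of_bool (r = r')"
  shows "thin form_matrix_coords
    {M :: complex^'v^'c^'n. \<exists>y. \<forall>r\<in>R. \<forall>j. (\<Sum>(i, k)\<in>UNIV. \<tau> r y (i, k) * M $ i $ j $ k) = 0}"
    (is "thin _ ?Bad")
proof -
  have inj: "inj_on piv R"
  proof (rule inj_onI)
    fix r r' assume "r \<in> R" "r' \<in> R" "piv r = piv r'"
    then show "r = r'" using piv[of r r undefined] piv[of r r' undefined] by (auto split: if_splits)
  qed
  define P where "P = piv ` R"
  define row where "row = inv_into R piv"
  have row: "row (piv r) = r" if "r \<in> R" for r using that inj by (simp add: row_def)
  define K' :: "('k + ('n \<times> 'v) \<times> 'c) set" where "K' = Inl ` K \<union> Inr ` ((- P) \<times> UNIV)"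
  have K': "finite K'" using assms(1) by (simp add: K'_def)
  \<comment> \<open>The entries at the pivots are given by the solved equations; all others are free.\<close>
  define \<phi> :: "('k + ('n \<times> 'v) \<times> 'c \<Rightarrow> complex) \<Rightarrow> complex^'v^'c^'n" where
    "\<phi> = (\<lambda>z. \<chi> i j k. if (i, k) \<in> P
        then - (\<Sum>e\<in>-P. \<tau> (row (i, k)) (\<lambda>l. z (Inl l)) e * z (Inr (e, j)))
        else z (Inr ((i, k), j)))"
  define c :: "'n \<times> 'c \<times> 'v \<Rightarrow> complex^'v^'c^'n \<Rightarrow> complex" where "c = (\<lambda>(i, j, k) M. M $ i $ j $ k)"
  have coords: "c ` UNIV = form_matrix_coords" unfolding c_def form_matrix_coords_def by (auto simp: image_iff) blast
  have "card K' = card K + card (- P) * CARD('c)"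
    using assms(1) unfolding K'_def
    by (subst card_Un_disjoint) (auto simp: card_image card_cartesian_product)
  also have "\<dots> < (card R + card (- P)) * CARD('c)"
    using assms(3) by (simp add: algebra_simps)
  also have "card R + card (- P) = CARD('n \<times> 'v)"
    using card_Compl_add[of P] inj by (simp add: P_def card_image)
  finally have card: "card K' < CARD('n \<times> 'c \<times> 'v)" by (simp add: algebra_simps)
  have "thin (c ` UNIV) (range \<phi>)"
  proof (rule thin_image[OF K' _ card])
    fix x :: "'n \<times> 'c \<times> 'v"
    obtain i j k where x: "x = (i, j, k)" by (cases x)
    have coordL: "(\<lambda>z. z (Inl l)) \<in> poly_funs {(\<lambda>y. y k) |k. k \<in> K'}" if "l \<in> K" for l
      using that by (intro poly_funs_coord) (auto simp: K'_def)
    have coordR: "(\<lambda>z. z (Inr (e, j))) \<in> poly_funs {(\<lambda>y. y k) |k. k \<in> K'}" if "e \<notin> P" for e j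
      using that by (intro poly_funs_coord) (auto simp: K'_def)
    show "(\<lambda>y. c x (\<phi> y)) \<in> poly_funs {(\<lambda>y. y k) |k. k \<in> K'}"
    proof (cases "(i, k) \<in> P")
      case True
      then have r: "row (i, k) \<in> R" by (auto simp: P_def row)
      have "(\<lambda>z. \<tau> (row (i, k)) (\<lambda>l. z (Inl l)) e) \<in> poly_funs {(\<lambda>y. y k) |k. k \<in> K'}" for e
        by (rule poly_funs_compose[OF poly[OF r]]) (auto intro!: coordL)
      then show ?thesis
        using True by (auto simp: c_def x \<phi>_def intro!: poly_funs_uminus poly_funs_sum
          poly_funs.mult coordR)
    next
      case False
      then show ?thesis by (auto simp: c_def x \<phi>_def intro!: coordR)
    qed
  next
    fix t :: "'n \<times> 'c \<times> 'v \<Rightarrow> complex"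
    show "\<exists>x. \<forall>i\<in>UNIV. c i x = t i"
      by (intro exI[of _ "\<chi> i j k. t (i, j, k)"]) (auto simp: c_def)
  qed simp
  moreover have "?Bad \<subseteq> range \<phi>"
  proof clarify
    fix M :: "complex^'v^'c^'n" and y
    assume y: "\<forall>r\<in>R. \<forall>j. (\<Sum>(i, k)\<in>UNIV. \<tau> r y (i, k) * M $ i $ j $ k) = 0"
    define z where "z = (\<lambda>l. case l of Inl l \<Rightarrow> y l | Inr ((i, k), j) \<Rightarrow> M $ i $ j $ k)"
    have "\<phi> z $ i $ j $ k = M $ i $ j $ k" for i j k
    proof (cases "(i, k) \<in> P")
      case False
      then show ?thesis by (simp add: \<phi>_def z_def)
    next
      case True
      then obtain r where r: "r \<in> R" "(i, k) = piv r" by (auto simp: P_def)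
      define X where "X = (\<lambda>e. M $ fst e $ j $ snd e)"
      have "0 = (\<Sum>e\<in>UNIV. \<tau> r y e * X e)"
        using y r(1) by (simp add: X_def case_prod_unfold)
      also have "\<dots> = (\<Sum>e\<in>P. \<tau> r y e * X e) + (\<Sum>e\<in>-P. \<tau> r y e * X e)"
        by (subst sum.union_disjoint[symmetric]) auto
      also have "(\<Sum>e\<in>P. \<tau> r y e * X e) = (\<Sum>r'\<in>R. \<tau> r y (piv r') * X (piv r'))"
        unfolding P_def by (subst sum.reindex[OF inj]) simp
      also have "\<dots> = (\<Sum>r'\<in>R. if r' = r then X (piv r') else 0)"
        using r by (intro sum.cong) (auto simp: piv)
      also have "\<dots> = X (piv r)" using r assms(2) by simp
      finally have "X (piv r) = - (\<Sum>e\<in>-P. \<tau> r y e * X e)" by (simp add: eq_neg_iff_add_eq_0)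
      then show ?thesis
        using True r by (simp add: \<phi>_def z_def row X_def case_prod_unfold) (metis fst_conv snd_conv)
    qed
    then have "M = \<phi> z" by (simp add: vec_eq_iff)
    then show "M \<in> range \<phi>" by blast
  qed
  ultimately show ?thesis unfolding coords by (rule thin_subset)
qed

section \<open>The two genericity conditions\<close>

text \<open>
  The linear form \<open>a\<^sup>t M\<^sub>u\<close>, identified with its coefficient vector.
\<close>

definition contraction :: "complex^'v^'c^'n \<Rightarrow> complex^'n \<Rightarrow> complex^'v \<Rightarrow> complex^'c" where
  "contraction M a u = (\<chi> j. \<Sum>(i, k)\<in>UNIV. a $ i * u $ k * M $ i $ j $ k)"

lemma contraction_add_left: "contraction M (a + a') u = contraction M a u + contraction M a' u"
  by (simp add: contraction_def vec_eq_iff algebra_simps sum.distrib case_prod_unfold)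

lemma contraction_add_right: "contraction M a (u + u') = contraction M a u + contraction M a u'"
  by (simp add: contraction_def vec_eq_iff algebra_simps sum.distrib case_prod_unfold)

lemma contraction_scale_left: "contraction M (x *s a) u = x *s contraction M a u"
  by (simp add: contraction_def vec_eq_iff sum_distrib_left mult.assoc case_prod_unfold)

lemma contraction_scale_right: "contraction M a (x *s u) = x *s contraction M a u"
  by (simp add: contraction_def vec_eq_iff sum_distrib_left mult.assoc mult.left_commute case_prod_unfold)

lemma Gr2_basis:
  assumes "W \<in> Gr 2"
  obtains a b where "a \<in> W" "b \<in> W" "W = vec.span {a, b}" "\<And>x y. x *s a + y *s b = 0 \<Longrightarrow> x = 0 \<and> y = 0"
proof -
  from assms have W: "vec.subspace W" "vec.dim W = 2" by (auto simp: Gr_def)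
  obtain B where B: "B \<subseteq> W" "vec.independent B" "W \<subseteq> vec.span B" "card B = 2"
    using vec.basis_exists[of W] W by metis
  then obtain a b where ab: "B = {a, b}" "a \<noteq> b" by (auto simp: card_2_iff)
  have 1: "x = 0 \<and> y = 0" if "x *s a + y *s b = 0" for x y
  proof -
    have ind: "\<And>c. (\<Sum>v\<in>{a, b}. c v *s v) = 0 \<Longrightarrow> \<forall>v\<in>{a, b}. c v = 0"
      using B(2) unfolding ab(1) vec.independent_explicit by blast
    show ?thesis using ind[of "\<lambda>v. if v = a then x else y"] that ab(2) by auto
  qed
  have "W = vec.span {a, b}" using B ab W by (metis vec.span_subspace)
  with that[of a b] 1 B(1) ab show thesis by auto
qed

text \<open>
  The finitely many choices of \<open>i\<close> are the standard affine charts of \<open>Gr 2\<close>; in such a chart a plane has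
  \<open>2 (d - 2)\<close> free coordinates, which is the dimension of the Grassmannian.
\<close>

lemma Gr2_echelon:
  assumes "W \<in> Gr 2"
  shows "\<exists>(i :: bool \<Rightarrow> 'd::finite) a. inj i \<and> (\<forall>p. a p \<in> W) \<and> (\<forall>p q. a p $ i q = of_bool (p = q))"
proof -
  from assms have W: "vec.subspace W" by (auto simp: Gr_def)
  obtain b c where bc: "b \<in> W" "c \<in> W" "\<And>x y. x *s b + y *s c = 0 \<Longrightarrow> x = 0 \<and> y = 0"
    using Gr2_basis[OF assms] by metis
  have "b \<noteq> 0" using bc(3)[of 1 0] by auto
  then obtain k where k: "b $ k \<noteq> 0" by (metis vec_eq_iff zero_index)
  define r where "r = c $ k / b $ k"
  define c' where "c' = c - r *s b"
  have "c' = (- r) *s b + 1 *s c" by (simp add: c'_def vec_eq_iff)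
  then have "c' \<noteq> 0" using bc(3)[of "- r" 1] by auto
  then obtain l where l: "c' $ l \<noteq> 0" by (metis vec_eq_iff zero_index)
  have c'k: "c' $ k = 0" using k by (simp add: c'_def r_def)
  with l have "k \<noteq> l" by auto
  define a1 where "a1 = (1 / c' $ l) *s c'"
  define a0 where "a0 = (1 / b $ k) *s b - (b $ l / b $ k) *s a1"
  have mem: "c' \<in> W" "a1 \<in> W" "a0 \<in> W"
    using bc(1,2) W unfolding a0_def a1_def c'_def
    by (auto intro!: vec.subspace_diff vec.subspace_scale)
  have vals: "a1 $ k = 0" "a1 $ l = 1" "a0 $ k = 1" "a0 $ l = 0"
    using k l c'k by (auto simp: a0_def a1_def)
  have "inj (\<lambda>p. if p then k else l)" using \<open>k \<noteq> l\<close> by (auto simp: inj_def)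
  with mem vals show ?thesis
    by (intro exI[of _ "\<lambda>p. if p then k else l"] exI[of _ "\<lambda>p. if p then a0 else a1"]) auto
qed

text \<open>
  The basis of the plane with coordinates \<open>f\<close> in the chart with pivots \<open>i\<close>: the pivot entries are
  prescribed, the others are free.
\<close>

definition echelon :: "(bool \<Rightarrow> 'd::finite) \<Rightarrow> (bool \<times> 'd \<Rightarrow> complex) \<Rightarrow> bool \<Rightarrow> 'd \<Rightarrow> complex" where
  "echelon i f p x = (if x \<in> range i then of_bool (x = i p) else f (p, x))"

lemma echelon_pivot: "inj i \<Longrightarrow> echelon i f p (i q) = of_bool (p = q)"
  by (auto simp: echelon_def inj_eq)

lemma echelon_eq:
  assumes "inj i" "\<And>p q. a p $ i q = of_bool (p = q)"
  shows "echelon i (\<lambda>(p, x). a p $ x) p x = a p $ x"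
  using assms by (auto simp: echelon_def inj_eq)

lemma poly_funs_echelon:
  assumes "\<And>x. x \<notin> range i \<Longrightarrow> (\<lambda>y. f y (p, x)) \<in> poly_funs C"
  shows "(\<lambda>y. echelon i (f y) p x) \<in> poly_funs C"
  using assms by (cases "x \<in> range i") (simp_all add: echelon_def poly_funs.const)

lemma card_Compl_range_bool: "inj i \<Longrightarrow> card (- range (i :: bool \<Rightarrow> 'd::finite)) + 2 = CARD('d)"
  using card_Compl_add[of "range i"] by (simp add: card_image)

text \<open>
  If \<open>W\<close> has echelon basis \<open>a False\<close>, \<open>a True\<close> with pivots \<open>i False\<close>, \<open>i True\<close> and \<open>u\<close> is scaled such that
  \<open>u $ k = 1\<close>, then the tensors \<open>a p \<otimes> u\<close> are in echelon form with pivots \<open>(i p, k)\<close>. The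
  assumption compares \<open>(CARD('v) - 1) + 2 (CARD('n) - 2)\<close> parameters with \<open>2 CARD('c)\<close> equations.
\<close>

lemma thin_corank_two:
  assumes "CARD('v) + 2 * CARD('n) < 2 * CARD('c) + 5"
  shows "thin form_matrix_coords {M :: complex^'v^'c^'n.
    \<exists>u W. u \<noteq> 0 \<and> W \<in> Gr 2 \<and> (\<forall>a\<in>W. contraction M a u = 0)}" (is "thin _ ?Bad")
proof -
  define A :: "'v \<times> (bool \<Rightarrow> 'n) \<Rightarrow> (complex^'v^'c^'n) set" where
    "A = (\<lambda>(k, i). {M. \<exists>u a. u $ k = 1 \<and> (\<forall>p q. a p $ i q = of_bool (p = q)) \<and>
        (\<forall>p. contraction M (a p) u = 0)})"
  have "thin form_matrix_coords (A (k, i))" if i: "inj i" for k i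
  proof -
    define K where "K = Inl ` (- {k}) \<union> Inr ` ((UNIV :: bool set) \<times> (- range i))"
    define \<tau> where "\<tau> = (\<lambda>p y (x, l). echelon i (\<lambda>e. y (Inr e)) p x * (if l = k then 1 else y (Inl l) :: complex))"
    have "card K = card (- {k}) + 2 * card (- range i)"
      unfolding K_def by (subst card_Un_disjoint) (auto simp: card_image card_cartesian_product)
    moreover have "card (- {k}) + 1 = CARD('v)"
      using card_Compl_add[of "{k}"] by simp
    ultimately have "card K < CARD('c) * card (UNIV :: bool set)"
      using card_Compl_range_bool[OF i] assms by simp
    then have "thin form_matrix_coords {M :: complex^'v^'c^'n. \<exists>y. \<forall>p\<in>UNIV. \<forall>j.
        (\<Sum>(x, l)\<in>UNIV. \<tau> p y (x, l) * M $ x $ j $ l) = 0}"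
    proof (rule thin_linear_conditions[where piv = "\<lambda>p. (i p, k)", rotated 2])
      fix p :: bool and e :: "'n \<times> 'v"
      obtain x l where e: "e = (x, l)" by (cases e)
      have "(\<lambda>y. if l = k then 1 else y (Inl l)) \<in> poly_funs {(\<lambda>y. y k) |k. k \<in> K}"
      proof (cases "l = k")
        case False
        then have "Inl l \<in> K" by (simp add: K_def)
        with False show ?thesis by (simp add: poly_funs_coord)
      qed (simp add: poly_funs.const)
      then show "(\<lambda>y. \<tau> p y e) \<in> poly_funs {(\<lambda>y. y k) |k. k \<in> K}"
        unfolding \<tau>_def e prod.case
        by (intro poly_funs.mult poly_funs_echelon poly_funs_coord) (simp_all add: K_def)
    qed (auto simp: \<tau>_def K_def echelon_pivot i)
    moreover have "A (k, i) \<subseteq> {M. \<exists>y. \<forall>p\<in>UNIV. \<forall>j. (\<Sum>(x, l)\<in>UNIV. \<tau> p y (x, l) * M $ x $ j $ l) = 0}"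
    proof clarify
      fix M assume "M \<in> A (k, i)"
      then obtain u a where ua: "u $ k = 1" "\<And>p q. a p $ i q = of_bool (p = q)"
        "\<And>p. contraction M (a p) u = 0" by (auto simp: A_def)
      define y where "y = (\<lambda>l. case l of Inl l \<Rightarrow> u $ l | Inr (p, x) \<Rightarrow> a p $ x)"
      have y: "(\<lambda>e. y (Inr e)) = (\<lambda>(p, x). a p $ x)" by (auto simp: y_def)
      have "\<tau> p y (x, l) = a p $ x * u $ l" for p x l
        using echelon_eq[OF i ua(2)] ua(1) unfolding \<tau>_def y by (auto simp: y_def)
      moreover have "(\<Sum>(x, l)\<in>UNIV. a p $ x * u $ l * M $ x $ j $ l) = 0" for p j
        using arg_cong[OF ua(3)[of p], of "\<lambda>v. v $ j"] by (simp add: contraction_def)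
      ultimately show "\<exists>y. \<forall>p\<in>UNIV. \<forall>j. (\<Sum>(x, l)\<in>UNIV. \<tau> p y (x, l) * M $ x $ j $ l) = 0"
        by (intro exI[of _ y]) simp
    qed
    ultimately show ?thesis by (rule thin_subset)
  qed
  then have "thin form_matrix_coords (\<Union>e\<in>UNIV \<times> {i. inj i}. A e)"
    by (intro thin_UN) auto
  moreover have "?Bad \<subseteq> (\<Union>e\<in>UNIV \<times> {i. inj i}. A e)"
  proof clarify
    fix M :: "complex^'v^'c^'n" and u W
    assume u: "u \<noteq> 0" and W: "W \<in> Gr 2" "\<forall>a\<in>W. contraction M a u = 0"
    obtain k where k: "u $ k \<noteq> 0" using u by (metis vec_eq_iff zero_index)
    obtain i :: "bool \<Rightarrow> 'n" and a where ia: "inj i" "\<And>p. a p \<in> W" "\<And>p q. a p $ i q = of_bool (p = q)"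
      using Gr2_echelon[OF W(1)] by blast
    have "M \<in> A (k, i)"
      unfolding A_def
      using ia W(2) k
      by (auto intro!: exI[of _ "(1 / u $ k) *s u"] exI[of _ a] simp: contraction_scale_right)
    then show "M \<in> (\<Union>e\<in>UNIV \<times> {i. inj i}. A e)" using ia(1) by auto
  qed
  ultimately show ?thesis by (rule thin_subset)
qed

text \<open>
  In echelon bases \<open>a\<close> of \<open>W\<^sub>1\<close> and \<open>u\<close> of \<open>W\<^sub>2\<close>, all four contractions are multiples
  \<open>c (p, q)\<close> of the one with indices \<open>(p\<^sub>0, q\<^sub>0)\<close>. So \<open>M\<close> vanishes on the three tensors
  \<open>a p \<otimes> u q - c (p, q) a p\<^sub>0 \<otimes> u q\<^sub>0\<close>, which are in echelon form with pivots \<open>(i p, k q)\<close> for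
  \<open>(p, q) \<noteq> (p\<^sub>0, q\<^sub>0)\<close>. The assumption compares \<open>2 (CARD('n) - 2) + 2 (CARD('v) - 2) + 3\<close> parameters
  with \<open>3 CARD('c)\<close> equations.
\<close>

lemma thin_rank_one:
  assumes "2 * CARD('n) + 2 * CARD('v) < 3 * CARD('c) + 5"
  shows "thin form_matrix_coords {M :: complex^'v^'c^'n.
    \<exists>W\<^sub>1\<in>Gr 2. \<exists>W\<^sub>2\<in>Gr 2. \<exists>f. \<forall>a\<in>W\<^sub>1. \<forall>u\<in>W\<^sub>2. contraction M a u \<in> vec.span {f}}" (is "thin _ ?Bad")
proof -
  define A :: "(bool \<Rightarrow> 'n) \<times> (bool \<Rightarrow> 'v) \<times> bool \<times> bool \<Rightarrow> (complex^'v^'c^'n) set" where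
    "A = (\<lambda>(i, k, p\<^sub>0, q\<^sub>0). {M. \<exists>a u c.
        (\<forall>p q. a p $ i q = of_bool (p = q)) \<and> (\<forall>p q. u p $ k q = of_bool (p = q)) \<and>
        (\<forall>p q. contraction M (a p) (u q) = c (p, q) *s contraction M (a p\<^sub>0) (u q\<^sub>0))})"
  have "thin form_matrix_coords (A (i, k, p\<^sub>0, q\<^sub>0))" if i: "inj i" and k: "inj k" for i k p\<^sub>0 q\<^sub>0
  proof -
    define R where "R = - {(p\<^sub>0, q\<^sub>0)}"
    define K where "K = Inl ` ((UNIV :: bool set) \<times> (- range i)) \<union> Inr ` (Inl ` ((UNIV :: bool set) \<times> (- range k)) \<union> Inr ` R)"
    define \<tau> where "\<tau> = (\<lambda>(p, q) y (x, l).
       echelon i (\<lambda>e. y (Inl e)) p x * echelon k (\<lambda>e. y (Inr (Inl e))) q l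
       - y (Inr (Inr (p, q))) * (echelon i (\<lambda>e. y (Inl e)) p\<^sub>0 x * echelon k (\<lambda>e. y (Inr (Inl e))) q\<^sub>0 l :: complex))"
    have R: "card R = 3"
      using card_Compl_add[of "{(p\<^sub>0, q\<^sub>0)}"] by (simp add: R_def)
    define K\<^sub>2 where "K\<^sub>2 = Inl ` ((UNIV :: bool set) \<times> (- range k)) \<union> Inr ` R"
    have "card K\<^sub>2 = 2 * card (- range k) + 3"
      unfolding K\<^sub>2_def by (subst card_Un_disjoint) (auto simp: card_image card_cartesian_product R)
    then have "card K = 2 * card (- range i) + (2 * card (- range k) + 3)"
      unfolding K_def K\<^sub>2_def[symmetric]
      by (subst card_Un_disjoint) (auto simp: card_image card_cartesian_product)
    then have "card K < CARD('c) * card R"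
      using card_Compl_range_bool[OF i] card_Compl_range_bool[OF k] assms R by simp
    then have "thin form_matrix_coords {M :: complex^'v^'c^'n. \<exists>y. \<forall>r\<in>R. \<forall>j.
        (\<Sum>(x, l)\<in>UNIV. \<tau> r y (x, l) * M $ x $ j $ l) = 0}"
    proof (rule thin_linear_conditions[where piv = "\<lambda>(p, q). (i p, k q)", rotated 2])
      fix r e assume "r \<in> R"
      then show "(\<lambda>y. \<tau> r y e) \<in> poly_funs {(\<lambda>y. y k) |k. k \<in> K}"
        unfolding \<tau>_def case_prod_unfold
        by (intro poly_funs.mult poly_funs_diff poly_funs_echelon poly_funs_coord) (auto simp: K_def)
    qed (auto simp: \<tau>_def K_def R_def echelon_pivot i k)
    moreover have "A (i, k, p\<^sub>0, q\<^sub>0) \<subseteq>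
        {M. \<exists>y. \<forall>r\<in>R. \<forall>j. (\<Sum>(x, l)\<in>UNIV. \<tau> r y (x, l) * M $ x $ j $ l) = 0}"
    proof clarify
      fix M assume "M \<in> A (i, k, p\<^sub>0, q\<^sub>0)"
      then obtain a u c where ua: "\<And>p q. a p $ i q = of_bool (p = q)" "\<And>p q. u p $ k q = of_bool (p = q)"
        "\<And>p q. contraction M (a p) (u q) = c (p, q) *s contraction M (a p\<^sub>0) (u q\<^sub>0)" by (auto simp: A_def)
      define y where "y = (\<lambda>l. case l of Inl (p, x) \<Rightarrow> a p $ x | Inr (Inl (p, x)) \<Rightarrow> u p $ x | Inr (Inr e) \<Rightarrow> c e)"
      have y: "(\<lambda>e. y (Inl e)) = (\<lambda>(p, x). a p $ x)" "(\<lambda>e. y (Inr (Inl e))) = (\<lambda>(p, x). u p $ x)"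
        by (auto simp: y_def)
      have \<tau>: "\<tau> (p, q) y (x, l) = a p $ x * u q $ l - c (p, q) * (a p\<^sub>0 $ x * u q\<^sub>0 $ l)" for p q x l
        using echelon_eq[OF i ua(1)] echelon_eq[OF k ua(2)] unfolding \<tau>_def y by (auto simp: y_def)
      have eq: "(\<Sum>(x, l)\<in>UNIV. \<tau> (p, q) y (x, l) * M $ x $ j $ l)
          = contraction M (a p) (u q) $ j - c (p, q) * contraction M (a p\<^sub>0) (u q\<^sub>0) $ j" for p q j
      proof -
        have "(\<Sum>(x, l)\<in>UNIV. \<tau> (p, q) y (x, l) * M $ x $ j $ l) =
            (\<Sum>(x, l)\<in>UNIV. a p $ x * u q $ l * M $ x $ j $ l
               - c (p, q) * (a p\<^sub>0 $ x * u q\<^sub>0 $ l * M $ x $ j $ l))"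
        proof (rule sum.cong[OF refl])
          fix e :: "'n \<times> 'v"
          obtain x l where e: "e = (x, l)" by (cases e)
          show "(case e of (x, l) \<Rightarrow> \<tau> (p, q) y (x, l) * M $ x $ j $ l) =
              (case e of (x, l) \<Rightarrow> a p $ x * u q $ l * M $ x $ j $ l
               - c (p, q) * (a p\<^sub>0 $ x * u q\<^sub>0 $ l * M $ x $ j $ l))"
            unfolding e prod.case \<tau> by (simp add: left_diff_distrib)
        qed
        also have "\<dots> = contraction M (a p) (u q) $ j - c (p, q) * contraction M (a p\<^sub>0) (u q\<^sub>0) $ j"
          unfolding contraction_def vec_lambda_beta split_def sum_subtractf sum_distrib_left ..
        finally show ?thesis .
      qed
      have "(\<Sum>(x, l)\<in>UNIV. \<tau> (p, q) y (x, l) * M $ x $ j $ l) = 0" for p q j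
        unfolding eq by (subst ua(3)[of p q]) simp
      then have "\<forall>r\<in>R. \<forall>j. (\<Sum>(x, l)\<in>UNIV. \<tau> r y (x, l) * M $ x $ j $ l) = 0"
        by auto
      then show "\<exists>y. \<forall>r\<in>R. \<forall>j. (\<Sum>(x, l)\<in>UNIV. \<tau> r y (x, l) * M $ x $ j $ l) = 0" by blast
    qed
    ultimately show ?thesis by (rule thin_subset)
  qed
  then have "thin form_matrix_coords (\<Union>e\<in>{i. inj i} \<times> {k. inj k} \<times> UNIV. A e)"
    by (intro thin_UN) auto
  moreover have "?Bad \<subseteq> (\<Union>e\<in>{i. inj i} \<times> {k. inj k} \<times> UNIV. A e)"
  proof clarify
    fix M :: "complex^'v^'c^'n" and W\<^sub>1 W\<^sub>2 f
    assume W: "W\<^sub>1 \<in> Gr 2" "W\<^sub>2 \<in> Gr 2" and f: "\<forall>a\<in>W\<^sub>1. \<forall>u\<in>W\<^sub>2. contraction M a u \<in> vec.span {f}"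
    obtain i :: "bool \<Rightarrow> 'n" and a where ia: "inj i" "\<And>p. a p \<in> W\<^sub>1" "\<And>p q. a p $ i q = of_bool (p = q)"
      using Gr2_echelon[OF W(1)] by blast
    obtain k :: "bool \<Rightarrow> 'v" and u where ku: "inj k" "\<And>p. u p \<in> W\<^sub>2" "\<And>p q. u p $ k q = of_bool (p = q)"
      using Gr2_echelon[OF W(2)] by blast
    have "\<forall>p q. \<exists>x. contraction M (a p) (u q) = x *s f"
    proof (intro allI)
      fix p q
      have "contraction M (a p) (u q) \<in> vec.span {f}" using f ia(2) ku(2) by blast
      then show "\<exists>x. contraction M (a p) (u q) = x *s f" by (auto simp: vec.span_singleton)
    qed
    then obtain x where x: "\<And>p q. contraction M (a p) (u q) = x p q *s f" by metis
    have "\<exists>p\<^sub>0 q\<^sub>0. \<forall>p q. \<exists>c. x p q = c * x p\<^sub>0 q\<^sub>0"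
    proof (cases "\<exists>p\<^sub>0 q\<^sub>0. x p\<^sub>0 q\<^sub>0 \<noteq> 0")
      case True
      then obtain p\<^sub>0 q\<^sub>0 where "x p\<^sub>0 q\<^sub>0 \<noteq> 0" by blast
      then have "x p q = x p q / x p\<^sub>0 q\<^sub>0 * x p\<^sub>0 q\<^sub>0" for p q by simp
      then show ?thesis by blast
    next
      case False
      then show ?thesis by auto
    qed
    then obtain p\<^sub>0 q\<^sub>0 c where c: "\<And>p q. x p q = c p q * x p\<^sub>0 q\<^sub>0" by metis
    have proportional: "contraction M (a p) (u q) = case_prod c (p, q) *s contraction M (a p\<^sub>0) (u q\<^sub>0)" for p q
      unfolding x[of p q] x[of p\<^sub>0 q\<^sub>0] by (subst c) simp
    have "M \<in> A (i, k, p\<^sub>0, q\<^sub>0)"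
      unfolding A_def prod.case mem_Collect_eq
      by (intro exI[of _ a] exI[of _ u] exI[of _ "case_prod c"] conjI allI) (rule ia(3) ku(3) proportional)+
    then show "M \<in> (\<Union>e\<in>{i. inj i} \<times> {k. inj k} \<times> UNIV. A e)" using ia(1) ku(1) by auto
  qed
  ultimately show ?thesis by (rule thin_subset)
qed

section \<open>Morphisms between subsets of Grassmannians\<close>

lemma poly_funs_frame_cong:
  assumes "f \<in> poly_funs (frame_coords k)" "\<And>i. i < k \<Longrightarrow> A i = B i"
  shows "f A = f B"
  using assms(1) by (induction rule: poly_funs.induct) (auto simp: frame_coords_def assms(2))

text \<open>
  A map \<open>h\<close> is a morphism if it lifts to frames by polynomial maps. An element \<open>(\<phi>, d)\<close> of \<open>\<Phi>\<close> is a
  lift \<open>\<phi>\<close> that is valid where \<open>d\<close> does not vanish. Regular functions are pulled back along any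
  valid lift. Since a closed set is defined by the vanishing of polynomials on \<^emph>\<open>all\<close> frames of a
  subspace, and these polynomials need not be invariant under change of frame, the assumption \<open>all\<close>
  requires that every frame of the image is reached by some lift; multiplying by \<open>d\<close> makes the pulled back
  equations void where the lift is not valid.
\<close>

lemma gr_morphismI:
  fixes h :: "(complex^'d::finite) set \<Rightarrow> (complex^'e::finite) set"
    and \<Phi> :: "(((nat \<Rightarrow> complex^'d) \<Rightarrow> nat \<Rightarrow> complex^'e) \<times> ((nat \<Rightarrow> complex^'d) \<Rightarrow> complex)) set"
  assumes maps: "\<And>W. W \<in> X \<Longrightarrow> h W \<in> Y"
    and poly: "\<And>\<phi> d i j. (\<phi>, d) \<in> \<Phi> \<Longrightarrow> i < l \<Longrightarrow> (\<lambda>A. \<phi> A i $ j) \<in> poly_funs (frame_coords k)"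
    and poly': "\<And>\<phi> d. (\<phi>, d) \<in> \<Phi> \<Longrightarrow> d \<in> poly_funs (frame_coords k)"
    and frame: "\<And>\<phi> d W A. (\<phi>, d) \<in> \<Phi> \<Longrightarrow> W \<in> X \<Longrightarrow> A \<in> frames k W \<Longrightarrow> d A \<noteq> 0 \<Longrightarrow> \<phi> A \<in> frames l (h W)"
    and all: "\<And>W A B. W \<in> X \<Longrightarrow> A \<in> frames k W \<Longrightarrow> B \<in> frames l (h W) \<Longrightarrow>
      \<exists>\<phi> d. (\<phi>, d) \<in> \<Phi> \<and> d A \<noteq> 0 \<and> (\<forall>i<l. \<phi> A i = B i)"
    and ex': "\<And>W. W \<in> X \<Longrightarrow> frames k W \<noteq> {}"
    and ex: "\<And>W. W \<in> X \<Longrightarrow> frames l (h W) \<noteq> {}"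
  shows "gr_morphism k l X Y h"
proof -
  have pullback: "(\<lambda>A. f (\<phi> A)) \<in> poly_funs (frame_coords k)"
    if "f \<in> poly_funs (frame_coords l)" "(\<phi>, d) \<in> \<Phi>" for f \<phi> d
    using that(1)
  proof (rule poly_funs_compose)
    fix c :: "(nat \<Rightarrow> complex^'e) \<Rightarrow> complex" assume "c \<in> frame_coords l"
    then obtain i j where "i < l" "c = (\<lambda>A. A i $ j)" by (auto simp: frame_coords_def)
    then show "(\<lambda>A. c (\<phi> A)) \<in> poly_funs (frame_coords k)" using poly[OF that(2)] by simp
  qed
  have "gr_openin k X (X \<inter> h -` V)" if "gr_openin l Y V" for V
  proof -
    from that obtain F where F: "F \<subseteq> poly_funs (frame_coords l)"
      "Y - V = {W \<in> Y. \<forall>A \<in> frames l W. \<forall>f \<in> F. f A = 0}"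
      unfolding gr_openin_def by blast
    define F' where "F' = {(\<lambda>A. d A * f (\<phi> A)) | d f \<phi>. (\<phi>, d) \<in> \<Phi> \<and> f \<in> F}"
    have "(\<lambda>A. d A * f (\<phi> A)) \<in> poly_funs (frame_coords k)" if "(\<phi>, d) \<in> \<Phi>" "f \<in> F" for d f \<phi>
      using that F(1) by (intro poly_funs.mult poly'[of \<phi> d] pullback[of f \<phi> d]) auto
    then have "F' \<subseteq> poly_funs (frame_coords k)" by (auto simp: F'_def)
    moreover have "X - (X \<inter> h -` V) = {W \<in> X. \<forall>A \<in> frames k W. \<forall>f \<in> F'. f A = 0}"
    proof (intro equalityI subsetI)
      fix W assume "W \<in> X - (X \<inter> h -` V)"
      then have W: "W \<in> X" "h W \<in> Y - V" using maps by auto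
      have "d A * f (\<phi> A) = 0" if "A \<in> frames k W" "(\<phi>, d) \<in> \<Phi>" "f \<in> F" for A d f \<phi>
        using frame[OF that(2) W(1) that(1)] W(2) that(3) unfolding F(2) by auto
      with W(1) show "W \<in> {W \<in> X. \<forall>A \<in> frames k W. \<forall>f \<in> F'. f A = 0}"
        by (auto simp: F'_def)
    next
      fix W assume "W \<in> {W \<in> X. \<forall>A \<in> frames k W. \<forall>f \<in> F'. f A = 0}"
      then have W: "W \<in> X" and zero: "\<And>A f. A \<in> frames k W \<Longrightarrow> f \<in> F' \<Longrightarrow> f A = 0" by auto
      have van: "d A * f (\<phi> A) = 0" if "A \<in> frames k W" "(\<phi>, d) \<in> \<Phi>" "f \<in> F" for A \<phi> d f
      proof -
        have "(\<lambda>A. d A * f (\<phi> A)) \<in> F'" unfolding F'_def using that by blast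
        from zero[OF that(1) this] show ?thesis .
      qed
      show "W \<in> X - (X \<inter> h -` V)"
      proof -
        obtain A where A: "A \<in> frames k W" using ex'[OF W] by blast
        have "f B = 0" if B: "B \<in> frames l (h W)" "f \<in> F" for B f
        proof -
          obtain \<phi> d where \<phi>: "(\<phi>, d) \<in> \<Phi>" "d A \<noteq> 0" "\<forall>i<l. \<phi> A i = B i"
            using all[OF W A B(1)] by blast
          have "f (\<phi> A) = f B"
            using \<phi>(3) B(2) F(1) by (intro poly_funs_frame_cong) auto
          with van[OF A \<phi>(1) B(2)] \<phi>(2) show ?thesis by simp
        qed
        then have "h W \<in> Y - V" unfolding F(2) using maps[OF W] by blast
        then show ?thesis using W by auto
      qed
    qed
    ultimately show ?thesis unfolding gr_openin_def by blast
  qed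
  moreover have "gr_regular k (X \<inter> h -` V) (f \<circ> h)" if "gr_regular l V f" for V f
    unfolding gr_regular_def
  proof (intro ballI)
    fix W A assume "W \<in> X \<inter> h -` V" and A: "A \<in> frames k W"
    then have W: "W \<in> X" "h W \<in> V" by auto
    obtain B where "B \<in> frames l (h W)" using ex[OF W(1)] by blast
    then obtain \<phi> d where \<phi>: "(\<phi>, d) \<in> \<Phi>" "d A \<noteq> 0" using all[OF W(1) A] by blast
    from frame[OF \<phi>(1) W(1) A \<phi>(2)] that W(2) obtain p q where
      pq: "p \<in> poly_funs (frame_coords l)" "q \<in> poly_funs (frame_coords l)" "q (\<phi> A) \<noteq> 0"
      "\<And>W' A'. W' \<in> V \<Longrightarrow> A' \<in> frames l W' \<Longrightarrow> q A' \<noteq> 0 \<Longrightarrow> f W' = p A' / q A'"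
      unfolding gr_regular_def by metis
    show "\<exists>p\<in>poly_funs (frame_coords k). \<exists>q\<in>poly_funs (frame_coords k). q A \<noteq> 0 \<and>
      (\<forall>W'\<in>X \<inter> h -` V. \<forall>A'\<in>frames k W'. q A' \<noteq> 0 \<longrightarrow> (f \<circ> h) W' = p A' / q A')"
    proof (rule bexI[of _ "\<lambda>A. d A * p (\<phi> A)"], rule bexI[of _ "\<lambda>A. d A * q (\<phi> A)"],
        intro conjI ballI impI)
      fix W' A' assume W': "W' \<in> X \<inter> h -` V" "A' \<in> frames k W'" "d A' * q (\<phi> A') \<noteq> 0"
      then have "f (h W') = p (\<phi> A') / q (\<phi> A')"
        by (intro pq(4) frame[OF \<phi>(1)]) auto
      then show "(f \<circ> h) W' = d A' * p (\<phi> A') / (d A' * q (\<phi> A'))" using W'(3) by simp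
    qed (use \<phi> pq in \<open>auto intro!: poly_funs.mult poly'[of \<phi> d] pullback[of _ \<phi> d]\<close>)
  qed
  ultimately show ?thesis unfolding gr_morphism_def using maps by blast
qed

lemma frames_span: "A \<in> frames k W \<Longrightarrow> vec.span (A ` {..<k}) = W"
  by (simp add: frames_def)

lemma frames_exist:
  assumes "W \<in> Gr k"
  obtains A where "A \<in> frames k W"
proof -
  from assms have W: "vec.subspace W" "vec.dim W = k" by (auto simp: Gr_def)
  obtain B where B: "B \<subseteq> W" "vec.independent B" "W \<subseteq> vec.span B" "card B = k"
    using vec.basis_exists[of W] W by metis
  have "finite B" using B(2) vec.finiteI_independent by blast
  then obtain A where "bij_betw A {..<k} B"
    using B(4) by (metis bij_betw_from_nat_into_finite ex_bij_betw_nat_finite atLeast0LessThan)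
  then have "vec.span (A ` {..<k}) = W"
    using B W(1) by (metis bij_betw_imp_surj_on vec.span_subspace)
  then show thesis using that by (auto simp: frames_def)
qed

lemma frames_independent:
  assumes "W \<in> Gr k" "A \<in> frames k W" "(\<Sum>i<k. c i *s A i) = 0" "i < k"
  shows "c i = 0"
proof -
  have span: "vec.span (A ` {..<k}) = W" and W: "vec.dim W = k"
    using assms by (auto simp: frames_def Gr_def)
  have card: "card (A ` {..<k}) = k"
  proof (rule antisym)
    show "card (A ` {..<k}) \<le> k" using card_image_le[of "{..<k}" A] by simp
    show "k \<le> card (A ` {..<k})" using vec.dim_le_card[of W "A ` {..<k}"] span W by simp
  qed
  then have inj: "inj_on A {..<k}" by (simp add: eq_card_imp_inj_on)
  have ind: "vec.independent (A ` {..<k})"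
  proof -
    have "A ` {..<k} \<subseteq> W" using vec.span_superset[of "A ` {..<k}"] span by simp
    then show ?thesis using vec.card_eq_dim[of "A ` {..<k}" W] card span W by simp
  qed
  define c' where "c' = (\<lambda>v. c (inv_into {..<k} A v))"
  have "(\<Sum>v\<in>A ` {..<k}. c' v *s v) = (\<Sum>i<k. c i *s A i)"
    by (subst sum.reindex[OF inj]) (use inj in \<open>auto simp: c'_def intro!: sum.cong\<close>)
  then have "(\<Sum>v\<in>A ` {..<k}. c' v *s v) = 0" using assms(3) by simp
  with ind have "\<forall>v\<in>A ` {..<k}. c' v = 0"
    unfolding vec.independent_explicit by blast
  then show ?thesis using inj assms(4) by (auto simp: c'_def)
qed

lemma span_frame_comb:
  assumes "v \<in> vec.span (A ` {..<k::nat})"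
  shows "\<exists>c. v = (\<Sum>i<k. c i *s A i)"
  using assms
proof (induction rule: vec.span_induct_alt)
  case base
  show ?case by (intro exI[of _ "\<lambda>_. 0"]) simp
next
  case (step a x y)
  then obtain c j where c: "y = (\<Sum>i<k. c i *s A i)" "j < k" "x = A j" by auto
  have "a *s x + y = (\<Sum>i<k. ((if i = j then a else 0) + c i) *s A i)"
    using c(2) by (simp add: c vec.scale_left_distrib sum.distrib if_distrib[of "\<lambda>t. t *s _"] cong: if_cong)
  then show ?case by (intro exI[of _ "\<lambda>i. (if i = j then a else 0) + c i"])
qed

text \<open>
  The action of a \<open>k \<times> k\<close> matrix \<open>g\<close> on \<open>k\<close>-tuples of vectors.
\<close>

definition recombine :: "nat \<Rightarrow> (nat \<Rightarrow> nat \<Rightarrow> complex) \<Rightarrow> (nat \<Rightarrow> complex^'d) \<Rightarrow> nat \<Rightarrow> complex^'d" where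
  "recombine k g A i = (\<Sum>l<k. g i l *s A l)"

text \<open>
  Any two frames of a subspace differ by an invertible matrix \<open>g\<close>. Invertibility is expressed by its
  effect on frames in any space, which is the form in which it is needed to turn one lift into all.
\<close>

lemma frames_transitive:
  fixes W :: "(complex^'d::finite) set"
  assumes "W \<in> Gr k" "A \<in> frames k W" "B \<in> frames k W"
  obtains g where "\<And>C :: nat \<Rightarrow> complex^'d. vec.span (recombine k g C ` {..<k}) = vec.span (C ` {..<k})"
    "\<And>i. i < k \<Longrightarrow> recombine k g A i = B i"
proof -
  have comb: "\<exists>g. \<forall>i. i < k \<longrightarrow> B' i = (\<Sum>l<k. g i l *s A' l)"
    if "A' \<in> frames k W" "B' \<in> frames k W" for A' B' :: "nat \<Rightarrow> complex^'d"
  proof -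
    have "\<exists>c. i < k \<longrightarrow> B' i = (\<Sum>l<k. c l *s A' l)" for i
    proof (cases "i < k")
      case True
      then have "B' i \<in> vec.span (A' ` {..<k})"
        using that vec.span_base[of "B' i" "B' ` {..<k}"] by (simp add: frames_def)
      then show ?thesis using span_frame_comb by blast
    qed simp
    then show ?thesis by (intro choice allI)
  qed
  obtain g where g: "\<And>i. i < k \<Longrightarrow> B i = (\<Sum>l<k. g i l *s A l)" using comb[OF assms(2,3)] by blast
  obtain g' where g': "\<And>i. i < k \<Longrightarrow> A i = (\<Sum>l<k. g' i l *s B l)" using comb[OF assms(3,2)] by blast
  \<comment> \<open>The matrices that express each frame in the other are inverse to each other.\<close>
  have inverse: "(\<Sum>l<k. g' i l * g l m) = of_bool (i = m)" if "i < k" "m < k" for i m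
  proof -
    have "A i = (\<Sum>l<k. \<Sum>m<k. (g' i l * g l m) *s A m)"
      by (subst g'[OF that(1)]) (auto simp: g vec.scale_sum_right intro!: sum.cong)
    also have "\<dots> = (\<Sum>m<k. (\<Sum>l<k. g' i l * g l m) *s A m)"
      by (subst sum.swap) (simp add: vec.scale_sum_left)
    finally have "(\<Sum>m<k. ((\<Sum>l<k. g' i l * g l m) - of_bool (m = i)) *s A m) = 0"
      using that(1) by (simp add: vec.scale_left_diff_distrib sum_subtractf of_bool_def if_distrib[of "\<lambda>t. t *s _"] cong: if_cong)
    from frames_independent[OF assms(1,2) this that(2)] show ?thesis by auto
  qed
  have "vec.span (recombine k g C ` {..<k}) = vec.span (C ` {..<k})" for C :: "nat \<Rightarrow> complex^'d"
  proof (rule antisym; rule vec.span_minimal)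
    show "recombine k g C ` {..<k} \<subseteq> vec.span (C ` {..<k})"
      by (auto simp: recombine_def intro!: vec.span_sum vec.span_scale intro: vec.span_base)
    have "C i = (\<Sum>l<k. g' i l *s recombine k g C l)" if "i < k" for i
    proof -
      have "(\<Sum>l<k. g' i l *s recombine k g C l) = (\<Sum>m<k. (\<Sum>l<k. g' i l * g l m) *s C m)"
        unfolding recombine_def vec.scale_sum_right vec.scale_sum_left
        by (subst sum.swap) simp
      also have "\<dots> = (\<Sum>m<k. of_bool (i = m) *s C m)"
        using that by (intro sum.cong) (auto simp: inverse)
      also have "\<dots> = C i"
        using that by (simp add: of_bool_def if_distrib[of "\<lambda>t. t *s _"] cong: if_cong)
      finally show ?thesis by simp
    qed
    then show "C ` {..<k} \<subseteq> vec.span (recombine k g C ` {..<k})"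
      by (auto intro!: vec.span_sum vec.span_scale intro: vec.span_base)
  qed auto
  then show thesis using that[of g] g by (simp add: recombine_def)
qed

section \<open>Duality between hyperplanes and points\<close>

text \<open>
  The bilinear pairing of coordinate vectors, without conjugation; it identifies the space with its dual.
\<close>

definition pairing :: "complex^'d \<Rightarrow> complex^'d \<Rightarrow> complex" where
  "pairing x y = (\<Sum>i\<in>UNIV. x $ i * y $ i)"

definition annihilator :: "(complex^'d) set \<Rightarrow> (complex^'d) set" where
  "annihilator W = {x. \<forall>y\<in>W. pairing x y = 0}"

lemma pairing_commute: "pairing x y = pairing y x"
  by (simp add: pairing_def mult.commute)

lemma pairing_linear [simp]:
  "pairing x (y + z) = pairing x y + pairing x z"
  "pairing (x + z) y = pairing x y + pairing z y"
  "pairing x (y - z) = pairing x y - pairing x z"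
  "pairing (x - z) y = pairing x y - pairing z y"
  "pairing x (c *s y) = c * pairing x y"
  "pairing (c *s x) y = c * pairing x y"
  "pairing x 0 = 0" "pairing 0 y = 0"
  by (simp_all add: pairing_def algebra_simps sum.distrib sum_subtractf sum_distrib_left)

lemma pairing_axis [simp]: "pairing x (axis i 1) = x $ i"
  by (simp add: pairing_def axis_def if_distrib[of "\<lambda>t. _ * t"] cong: if_cong)

lemma annihilator_span_singleton: "annihilator (vec.span {x}) = {y. pairing x y = 0}"
proof (intro equalityI subsetI)
  fix y assume "y \<in> annihilator (vec.span {x})"
  then have "pairing y x = 0" by (simp add: annihilator_def vec.span_base)
  then show "y \<in> {y. pairing x y = 0}" by (simp add: pairing_commute)
next
  fix y assume "y \<in> {y. pairing x y = 0}"
  then have "pairing y x = 0" by (simp add: pairing_commute)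
  then show "y \<in> annihilator (vec.span {x})" by (auto simp: annihilator_def vec.span_singleton)
qed

text \<open>
  A vector \<open>y\<close> with \<open>pairing x y = 1\<close> spans a complement of the hyperplane of \<open>x\<close>.
\<close>

lemma hyperplane_split:
  fixes x :: "complex^'d::finite"
  assumes "x \<noteq> 0"
  obtains y where "pairing x y = 1" "\<And>z. z - pairing x z *s y \<in> {z. pairing x z = 0}"
proof -
  obtain i where i: "x $ i \<noteq> 0" using assms by (metis vec_eq_iff zero_index)
  show thesis by (rule that[of "(1 / x $ i) *s axis i 1"]) (use i in auto)
qed

lemma subspace_hyperplane: "vec.subspace {z. pairing x z = 0}"
  by (auto simp: vec.subspace_def)

lemma dim_hyperplane:
  fixes x :: "complex^'d::finite"
  assumes "x \<noteq> 0"
  shows "vec.dim {z. pairing x z = 0} + 1 = CARD('d)"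
proof -
  let ?H = "{z. pairing x z = 0}"
  obtain y where y: "pairing x y = 1" "\<And>z. z - pairing x z *s y \<in> ?H"
    using hyperplane_split[OF assms] by metis
  have "y \<notin> vec.span ?H" using y(1) subspace_hyperplane[of x] by (simp add: vec.span_eq_iff[THEN iffD2])
  then have "vec.dim ?H + 1 = vec.dim (insert y ?H)" by (simp add: vec.dim_insert)
  also have "\<dots> = vec.dim (vec.span (insert y ?H))" by simp
  also have "vec.span (insert y ?H) = UNIV"
  proof -
    have "z \<in> vec.span (insert y ?H)" for z
      using vec.span_base[OF y(2)[of z]] unfolding vec.span_insert by blast
    then show ?thesis by auto
  qed
  finally show ?thesis by (simp add: card_cart_basis)
qed

lemma annihilator_hyperplane:
  fixes x :: "complex^'d::finite"
  assumes "x \<noteq> 0"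
  shows "annihilator {z. pairing x z = 0} = vec.span {x}"
proof (intro equalityI subsetI)
  fix w assume w: "w \<in> annihilator {z. pairing x z = 0}"
  obtain y where y: "pairing x y = 1" "\<And>z. z - pairing x z *s y \<in> {z. pairing x z = 0}"
    using hyperplane_split[OF assms] by metis
  have "w $ i = pairing w y * x $ i" for i
  proof -
    have "pairing w (axis i 1 - pairing x (axis i 1) *s y) = 0"
      using w y(2) unfolding annihilator_def by blast
    then show ?thesis by simp
  qed
  then have "w = pairing w y *s x" by (simp add: vec_eq_iff)
  then show "w \<in> vec.span {x}" by (auto simp: vec.span_singleton)
next
  fix w assume "w \<in> vec.span {x}"
  then show "w \<in> annihilator {z. pairing x z = 0}"
    by (auto simp: vec.span_singleton annihilator_def)
qed

lemma Gr_1_iff: "p \<in> Gr 1 \<longleftrightarrow> (\<exists>x. x \<noteq> 0 \<and> p = vec.span {x})" for p :: "(complex^'d::finite) set"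
proof
  assume "p \<in> Gr 1"
  then have p: "vec.subspace p" "vec.dim p = 1" by (auto simp: Gr_def)
  obtain B where B: "B \<subseteq> p" "vec.independent B" "p \<subseteq> vec.span B" "card B = 1"
    using vec.basis_exists[of p] p by metis
  then obtain x where x: "B = {x}" by (auto simp: card_1_singleton_iff)
  then have "x \<noteq> 0" using B(2) by simp
  moreover have "p = vec.span {x}" using B x p by (metis vec.span_subspace)
  ultimately show "\<exists>x. x \<noteq> 0 \<and> p = vec.span {x}" by blast
next
  assume "\<exists>x. x \<noteq> 0 \<and> p = vec.span {x}"
  then show "p \<in> Gr 1" by (auto simp: Gr_def)
qed

lemma frames_1_iff: "B \<in> frames 1 p \<longleftrightarrow> vec.span {B 0} = p" "B \<in> frames (Suc 0) p \<longleftrightarrow> vec.span {B 0} = p"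
  by (simp_all add: frames_def lessThan_Suc)

lemma span_singleton_eq_iff:
  fixes x y :: "complex^'d::finite"
  assumes "vec.span {y} = vec.span {x}" "x \<noteq> 0"
  obtains t where "t \<noteq> 0" "y = t *s x"
proof -
  have "x \<in> vec.span {y}" "y \<in> vec.span {x}" using assms(1) vec.span_base by auto
  then obtain t where t: "y = t *s x" unfolding vec.span_singleton by blast
  have "t \<noteq> 0" using \<open>x \<in> vec.span {y}\<close> t assms(2) by auto
  then show thesis using that t by blast
qed

lemma span_singleton_scale:
  fixes x :: "complex^'d::finite"
  assumes "t \<noteq> 0"
  shows "vec.span {t *s x} = vec.span {x}"
proof -
  have "x = (1 / t) *s (t *s x)" using assms by simp
  then have "x \<in> vec.span {t *s x}" unfolding vec.span_singleton by blast
  moreover have "t *s x \<in> vec.span {x}" unfolding vec.span_singleton by blast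
  ultimately show ?thesis by (meson empty_subsetI insert_subset subset_antisym vec.span_minimal vec.subspace_span)
qed

lemma hyperplane_in_Gr:
  fixes x :: "complex^'d::finite"
  assumes "x \<noteq> 0"
  shows "{z. pairing x z = 0} \<in> Gr (CARD('d) - 1)"
  using dim_hyperplane[OF assms] subspace_hyperplane[of x] by (simp add: Gr_def)

text \<open>
  The generalised cross product: the vector of maximal minors of the rows \<open>Y 0, ..., Y (d - 2)\<close>, up to sign. The
  row \<open>r\<^sub>0\<close> is reserved for the free argument, and \<open>idx\<close> numbers the other rows.
\<close>

definition cross :: "'d \<Rightarrow> ('d \<Rightarrow> nat) \<Rightarrow> (nat \<Rightarrow> complex^'d) \<Rightarrow> complex^'d::finite" where
  "cross r\<^sub>0 idx Y = (\<chi> j. det (\<chi> r. if r = r\<^sub>0 then axis j 1 else Y (idx r)))"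

lemma pairing_cross:
  "pairing (cross r\<^sub>0 idx Y) z = det (\<chi> r. if r = r\<^sub>0 then z else Y (idx r))"
proof -
  have "det (\<chi> r. if r = r\<^sub>0 then z else Y (idx r))
      = det (\<chi> r. if r = r\<^sub>0 then (\<Sum>j\<in>UNIV. z $ j *s axis j 1) else Y (idx r))"
    by (simp only: basis_expansion)
  also have "\<dots> = (\<Sum>j\<in>UNIV. det (\<chi> r. if r = r\<^sub>0 then z $ j *s axis j 1 else Y (idx r)))"
    by (rule det_linear_row_sum) simp
  also have "\<dots> = (\<Sum>j\<in>UNIV. z $ j * det (\<chi> r. if r = r\<^sub>0 then axis j 1 else Y (idx r)))"
    by (simp add: det_row_mul)
  also have "\<dots> = pairing (cross r\<^sub>0 idx Y) z"
    by (simp add: pairing_def cross_def mult.commute)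
  finally show ?thesis by simp
qed

text \<open>
  By the lemma above the cross product pairs with \<open>z\<close> to the determinant with rows \<open>Y i\<close> and \<open>z\<close>. This is zero for
  \<open>z = Y i\<close>, and nonzero for \<open>z\<close> outside \<open>W\<close>, so the cross product of a frame of a hyperplane is an
  equation of the hyperplane. This is what makes the map from hyperplanes to points polynomial on frames.
\<close>

lemma annihilator_cross:
  fixes W :: "(complex^'d::finite) set"
  assumes W: "W \<in> Gr (CARD('d) - 1)" "Y \<in> frames (CARD('d) - 1) W"
    and idx: "bij_betw idx (UNIV - {r\<^sub>0}) {..<CARD('d) - 1}"
  shows "cross r\<^sub>0 idx Y \<noteq> 0" "W = {z. pairing (cross r\<^sub>0 idx Y) z = 0}"
    "annihilator W = vec.span {cross r\<^sub>0 idx Y}"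
proof -
  let ?k = "CARD('d) - 1" and ?c = "cross r\<^sub>0 idx Y"
  have sub: "vec.subspace W" and dim: "vec.dim W = ?k" using W(1) by (auto simp: Gr_def)
  have span: "vec.span (Y ` {..<?k}) = W" using W(2) by (rule frames_span)
  have pos: "CARD('d) > 0" by simp
  then have "?k \<noteq> CARD('d)" by linarith
  then have "W \<noteq> UNIV" using dim by (auto simp: card_cart_basis)
  then obtain z where z: "z \<notin> W" by blast
  let ?M = "\<chi> r. if r = r\<^sub>0 then z else Y (idx r)"
  have idx_surj: "\<exists>r. r \<noteq> r\<^sub>0 \<and> idx r = i" if "i < ?k" for i
  proof -
    have "i \<in> idx ` (UNIV - {r\<^sub>0})" using bij_betw_imp_surj_on[OF idx] that by simp
    then show ?thesis by auto
  qed
  have "vec.span (rows ?M) = UNIV"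
  proof -
    have "Y i \<in> rows ?M" if i: "i < ?k" for i
    proof -
      obtain r where "r \<noteq> r\<^sub>0" "idx r = i"
        using idx_surj[OF i] by blast
      then have "row r ?M = Y i" by (simp add: row_def vec_eq_iff)
      then show ?thesis unfolding rows_def by (intro CollectI exI[of _ r]) simp
    qed
    then have "W \<subseteq> vec.span (rows ?M)"
      unfolding span[symmetric] by (intro vec.span_mono) auto
    moreover have "row r\<^sub>0 ?M = z" by (simp add: row_def vec_eq_iff)
    then have "z \<in> vec.span (rows ?M)" unfolding rows_def by (intro vec.span_base CollectI exI[of _ r\<^sub>0]) simp
    ultimately have "insert z W \<subseteq> vec.span (rows ?M)" by blast
    then have "vec.dim (insert z W) \<le> vec.dim (rows ?M)"
      by (rule vec.dim_mono)
    moreover have "vec.dim (insert z W) = CARD('d)"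
      using z sub dim pos by (simp add: vec.dim_insert vec.span_eq_iff[THEN iffD2])
    ultimately have "vec.dim (rows ?M) = CARD('d)"
      using vec.dim_subset_UNIV[of "rows ?M"] by (simp add: vec.dimension_def card_cart_basis)
    then show ?thesis
      using vec.dim_eq_full[of "rows ?M"] by (simp add: vec.dimension_def card_cart_basis)
  qed
  then have "det ?M \<noteq> 0"
    using matrix_left_invertible_span_rows_gen[of ?M] invertible_left_inverse[of ?M]
      invertible_det_nz[of ?M] by blast
  then have "pairing ?c z \<noteq> 0" by (simp add: pairing_cross)
  then show c: "?c \<noteq> 0" by auto
  have "pairing ?c (Y i) = 0" if i: "i < ?k" for i
  proof -
    obtain r where r: "r \<noteq> r\<^sub>0" "idx r = i"
      using idx_surj[OF i] by blast
    show ?thesis unfolding pairing_cross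
      by (rule det_identical_rows[OF r(1)]) (use r in \<open>simp add: row_def vec_eq_iff\<close>)
  qed
  then have "W \<subseteq> {z. pairing ?c z = 0}"
    unfolding span[symmetric] by (intro vec.span_minimal subspace_hyperplane) auto
  then show eq: "W = {z. pairing ?c z = 0}"
    using dim dim_hyperplane[OF c] by (intro vec.subspace_dim_equal sub subspace_hyperplane) auto
  show "annihilator W = vec.span {?c}" unfolding eq by (rule annihilator_hyperplane[OF c])
qed

lemma poly_funs_det:
  assumes "\<And>r s. (\<lambda>A. m A $ r $ s) \<in> poly_funs C"
  shows "(\<lambda>A. det (m A)) \<in> poly_funs C"
  unfolding det_def
  by (intro poly_funs_sum poly_funs.mult poly_funs.const poly_funs_prod assms) auto

text \<open>
  The inverse direction: where \<open>x $ j \<noteq> 0\<close>, the vectors \<open>x\<^sub>j e\<^sub>b - x\<^sub>b e\<^sub>j\<close> with \<open>b \<noteq> j\<close> form a frame of the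
  hyperplane of \<open>x\<close> that depends polynomially on \<open>x\<close>. The matrix \<open>P\<close> transports it to another space.
\<close>

lemma hyperplane_frame:
  fixes x :: "complex^'q::finite" and P :: "complex^'q^'c::finite"
  assumes "x $ j \<noteq> 0" "bij_betw e {..<k} (UNIV - {j})"
  shows "vec.span ((\<lambda>l. x $ j *s (P *v axis (e l) 1) - x $ (e l) *s (P *v axis j 1)) ` {..<k})
    = (*v) P ` {z. pairing x z = 0}"
proof -
  define v where "v = (\<lambda>l. x $ j *s axis (e l) 1 - x $ (e l) *s axis j (1::complex))"
  have "vec.span (v ` {..<k}) = {z. pairing x z = 0}"
  proof (rule antisym)
    show "vec.span (v ` {..<k}) \<subseteq> {z. pairing x z = 0}"
      by (intro vec.span_minimal subspace_hyperplane) (auto simp: v_def)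
    show "{z. pairing x z = 0} \<subseteq> vec.span (v ` {..<k})"
    proof
      fix z assume "z \<in> {z. pairing x z = 0}"
      then have z: "pairing x z = 0" by simp
      have sum: "(\<Sum>l<k. g (e l)) = (\<Sum>i\<in>UNIV - {j}. g i)" for g :: "'q \<Rightarrow> complex"
        by (rule sum.reindex_bij_betw[OF assms(2)])
      have "z $ i = (\<Sum>l<k. (z $ e l / x $ j) *s v l) $ i" for i
      proof -
        have "(\<Sum>l<k. (z $ e l / x $ j) *s v l) $ i
            = (\<Sum>l<k. (\<lambda>b. z $ b / x $ j * (x $ j * axis b 1 $ i - x $ b * axis j 1 $ i)) (e l))"
          by (simp only: v_def sum_component vector_smult_component vector_minus_component)
        also have "\<dots> = (\<Sum>b\<in>UNIV - {j}. z $ b / x $ j * (x $ j * axis b 1 $ i - x $ b * axis j 1 $ i))"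
          by (rule sum)
        also have "\<dots> = z $ i"
        proof (cases "i = j")
          case True
          have "(\<Sum>b\<in>UNIV - {j}. z $ b / x $ j * (x $ j * axis b 1 $ i - x $ b * axis j 1 $ i))
              = (\<Sum>b\<in>UNIV - {j}. - (x $ b * z $ b) / x $ j)"
            using True by (intro sum.cong) (auto simp: axis_def)
          also have "\<dots> = - (\<Sum>b\<in>UNIV - {j}. x $ b * z $ b) / x $ j"
            by (simp add: sum_divide_distrib sum_negf)
          also have "(\<Sum>b\<in>UNIV - {j}. x $ b * z $ b) = - (x $ j * z $ j)"
            using z sum.remove[of UNIV j "\<lambda>b. x $ b * z $ b"] by (simp add: pairing_def eq_neg_iff_add_eq_0 add.commute)
          finally show ?thesis using True assms(1) by simp
        next
          case False
          have "(\<Sum>b\<in>UNIV - {j}. z $ b / x $ j * (x $ j * axis b 1 $ i - x $ b * axis j 1 $ i))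
              = (\<Sum>b\<in>UNIV - {j}. if b = i then z $ b else 0)"
            using False assms(1) by (intro sum.cong) (auto simp: axis_def)
          then show ?thesis using False by simp
        qed
        finally show ?thesis by simp
      qed
      then have "z = (\<Sum>l<k. (z $ e l / x $ j) *s v l)" unfolding vec_eq_iff by blast
      also have "\<dots> \<in> vec.span (v ` {..<k})"
        by (intro vec.span_sum vec.span_scale vec.span_base) auto
      finally show "z \<in> vec.span (v ` {..<k})" .
    qed
  qed
  then have "(*v) P ` {z. pairing x z = 0} = vec.span ((*v) P ` v ` {..<k})"
    by (simp add: vec.span_image)
  also have "(*v) P ` v ` {..<k} = (\<lambda>l. x $ j *s (P *v axis (e l) 1) - x $ (e l) *s (P *v axis j 1)) ` {..<k}"
    by (simp add: image_image v_def vec.diff vec.scale)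
  finally show ?thesis ..
qed

lemma hyperplane_parametrisation:
  fixes f :: "complex^'c::finite"
  assumes "f \<noteq> 0" "CARD('q::finite) + 1 = CARD('c)"
  shows "\<exists>(P :: complex^'q^'c) (Q :: complex^'c^'q).
    (\<forall>y. Q *v (P *v y) = y) \<and> range ((*v) P) = {z. pairing f z = 0}"
proof -
  have "vec.dim (UNIV :: (complex^'q) set) = vec.dim {z. pairing f z = 0}"
    using dim_hyperplane[OF assms(1)] assms(2) by (simp add: card_cart_basis)
  from vec.subspace_isomorphism[OF vec.subspace_UNIV subspace_hyperplane this]
  obtain g :: "complex^'q \<Rightarrow> complex^'c" where
    g: "Vector_Spaces.linear (*s) (*s) g" "range g = {z. pairing f z = 0}" "inj g" by blast
  have P: "(*v) (matrix g) = g" using g(1) by (auto simp: matrix_works)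
  with g(3) obtain Q where "Q ** matrix g = mat 1"
    using matrix_left_invertible_injective[of "matrix g"] by auto
  then have "Q *v (matrix g *v y) = y" for y by (simp add: matrix_vector_mul_assoc)
  moreover have "range ((*v) (matrix g)) = {z. pairing f z = 0}" unfolding P by (rule g(2))
  ultimately show ?thesis by blast
qed

text \<open>
  The subspaces in question are the hyperplanes of the space \<open>f = 0\<close>. After a linear identification
  \<open>P\<close> of that space with the coordinate space, with left inverse \<open>Q\<close>, the isomorphism sends a hyperplane to
  its annihilator, and a point to its annihilator.
\<close>

lemma hyperplane_sections_isomorphic_proj_space:
  fixes f :: "complex^'c::finite"
  assumes f: "f \<noteq> 0" and card: "CARD('q::finite) + 1 = CARD('c)"
  shows "gr_isomorphic (CARD('c) - 2) 1 {W \<in> Gr (CARD('c) - 2). W \<subseteq> {z. pairing f z = 0}}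
    (proj_space :: (complex^'q) set set)" (is "gr_isomorphic ?k 1 ?X ?Y")
proof -
  obtain P :: "complex^'q^'c" and Q :: "complex^'c^'q" where QP: "\<And>y. Q *v (P *v y) = y"
    and range: "range ((*v) P) = {z. pairing f z = 0}"
    using hyperplane_parametrisation[OF assms] by blast
  have k: "?k = CARD('q) - 1" using card by simp
  obtain r\<^sub>0 :: 'q where True by blast
  have "\<exists>e. bij_betw e {..<?k} (UNIV - {j :: 'q})" for j
    using ex_bij_betw_nat_finite[of "UNIV - {j}"] by (simp add: k atLeast0LessThan)
  then obtain e where e: "\<And>j :: 'q. bij_betw (e j) {..<?k} (UNIV - {j})" by metis
  define idx where "idx = inv_into {..<?k} (e r\<^sub>0)"
  have idx: "bij_betw idx (UNIV - {r\<^sub>0}) {..<CARD('q) - 1}"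
    unfolding idx_def k[symmetric] by (rule bij_betw_inv_into[OF e])
  have PQ: "P *v (Q *v w) = w" if "pairing f w = 0" for w
  proof -
    have "w \<in> range ((*v) P)" using that range by simp
    then show ?thesis using QP by auto
  qed
  define h where "h = (\<lambda>W. annihilator ((*v) Q ` W))"
  define h' where "h' = (\<lambda>p. (*v) P ` annihilator p)"
  define c where "c = (\<lambda>A. cross r\<^sub>0 idx (\<lambda>i. Q *v A i))"
  have PQW: "(*v) P ` (*v) Q ` W = W" if "W \<in> ?X" for W
  proof -
    have "P *v (Q *v w) = w" if "w \<in> W" for w using that \<open>W \<in> ?X\<close> PQ by blast
    then show ?thesis by (simp add: image_image)
  qed
  have c: "c A \<noteq> 0" "(*v) Q ` W = {z. pairing (c A) z = 0}" "h W = vec.span {c A}"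
    if W: "W \<in> ?X" "A \<in> frames ?k W" for W A
  proof -
    have "vec.dim ((*v) Q ` W) \<le> vec.dim W" by (rule vec.dim_image_le) (rule matrix_vector_mul_linear_gen)
    moreover have "vec.dim ((*v) P ` (*v) Q ` W) \<le> vec.dim ((*v) Q ` W)"
      by (rule vec.dim_image_le) (rule matrix_vector_mul_linear_gen)
    ultimately have "vec.dim ((*v) Q ` W) = ?k" using W(1) unfolding PQW[OF W(1)] by (simp add: Gr_def)
    moreover have "vec.subspace ((*v) Q ` W)"
      using W(1) by (intro vec.subspace_image) (simp add: Gr_def)
    ultimately have 1: "(*v) Q ` W \<in> Gr (CARD('q) - 1)" by (simp add: Gr_def k)
    have "vec.span ((\<lambda>i. Q *v A i) ` {..<?k}) = (*v) Q ` W"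
      using frames_span[OF W(2)] vec.span_image[of Q "A ` {..<?k}"] by (simp add: image_image)
    then have 2: "(\<lambda>i. Q *v A i) \<in> frames (CARD('q) - 1) ((*v) Q ` W)" by (simp add: frames_def k)
    show "c A \<noteq> 0" "(*v) Q ` W = {z. pairing (c A) z = 0}" "h W = vec.span {c A}"
      using annihilator_cross[OF 1 2 idx] by (simp_all add: c_def h_def)
  qed
  have frX: "frames ?k W \<noteq> {}" if "W \<in> ?X" for W
    using that frames_exist[of W ?k] by blast
  have hY: "h W \<in> ?Y" if W: "W \<in> ?X" for W
  proof -
    obtain A where A: "A \<in> frames ?k W" using frX[OF W] by blast
    show ?thesis using c(1,3)[OF W A] unfolding Gr_1_iff by blast
  qed
  have h'_span: "h' (vec.span {x}) = (*v) P ` {z. pairing x z = 0}" for x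
    by (simp add: h'_def annihilator_span_singleton)
  have h'X: "h' p \<in> ?X" if p: "p \<in> ?Y" for p
  proof -
    from p obtain x where x: "x \<noteq> 0" "p = vec.span {x}" unfolding Gr_1_iff by blast
    have "vec.subspace {z. pairing x z = 0}" "vec.dim {z. pairing x z = 0} = ?k"
      using hyperplane_in_Gr[OF x(1)] by (auto simp: Gr_def k)
    moreover have "inj ((*v) P)" using QP by (metis injI)
    ultimately have "h' p \<in> Gr ?k"
      unfolding x(2) h'_span Gr_def
      by (auto intro!: vec.subspace_image simp: vec.dim_image_eq[OF matrix_vector_mul_linear_gen] inj_on_subset)
    moreover have "h' p \<subseteq> {z. pairing f z = 0}" using range by (auto simp: h'_def)
    ultimately show ?thesis by blast
  qed
  have inv1: "h' (h W) = W" if W: "W \<in> ?X" for W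
  proof -
    obtain A where A: "A \<in> frames ?k W" using frX[OF W] by blast
    show ?thesis unfolding c(3)[OF W A] h'_span c(2)[OF W A, symmetric] by (rule PQW[OF W])
  qed
  have inv2: "h (h' p) = p" if p: "p \<in> ?Y" for p
  proof -
    from p obtain x where x: "x \<noteq> 0" "p = vec.span {x}" unfolding Gr_1_iff by blast
    show ?thesis unfolding x(2) h'_span h_def by (simp add: image_image QP annihilator_hyperplane[OF x(1)])
  qed
  have "gr_morphism ?k 1 ?X ?Y h"
  \<comment> \<open>A frame of a point is a nonzero vector, so scaling by \<open>t\<close> reaches all frames of the image.\<close>
  proof (rule gr_morphismI[where \<Phi> = "{(\<lambda>A i. t *s c A, \<lambda>_. 1) | t. t \<noteq> 0}"])
    fix \<phi> :: "(nat \<Rightarrow> complex^'c) \<Rightarrow> nat \<Rightarrow> complex^'q" and d :: "(nat \<Rightarrow> complex^'c) \<Rightarrow> complex" and i :: nat and j :: 'q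
    assume "(\<phi>, d) \<in> {(\<lambda>A i. t *s c A, \<lambda>_. 1) | t. t \<noteq> 0}"
    then obtain t where \<phi>: "\<phi> = (\<lambda>A i. t *s c A)" "d = (\<lambda>_. 1)" by blast
    have "(\<lambda>A. (if r = r\<^sub>0 then axis j 1 else Q *v A (idx r)) $ s) \<in> poly_funs (frame_coords ?k)" for r s
    proof (cases "r = r\<^sub>0")
      case False
      then have "idx r < ?k" using idx unfolding bij_betw_def k by auto
      then have "(\<lambda>A. A (idx r) $ l) \<in> poly_funs (frame_coords ?k)" for l
        by (intro poly_funs.coord) (auto simp: frame_coords_def)
      then show ?thesis
        using False by (auto simp: matrix_vector_mult_def intro!: poly_funs_sum poly_funs.mult poly_funs.const)
    qed (simp add: poly_funs.const)
    then show "(\<lambda>A. \<phi> A i $ j) \<in> poly_funs (frame_coords ?k)"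
      unfolding \<phi>(1) c_def cross_def
      by (auto intro!: poly_funs.mult poly_funs.const poly_funs_det)
    show "d \<in> poly_funs (frame_coords ?k)" unfolding \<phi>(2) by (rule poly_funs.const)
  next
    fix \<phi> :: "(nat \<Rightarrow> complex^'c) \<Rightarrow> nat \<Rightarrow> complex^'q" and d :: "(nat \<Rightarrow> complex^'c) \<Rightarrow> complex" and W A
    assume \<phi>: "(\<phi>, d) \<in> {(\<lambda>A i. t *s c A, \<lambda>_. 1) | t. t \<noteq> 0}"
      and W: "W \<in> ?X" "A \<in> frames ?k W"
    then show "\<phi> A \<in> frames 1 (h W)"
      by (auto simp: frames_1_iff c(3)[OF W] span_singleton_scale)
  next
    fix W A B assume W: "W \<in> ?X" "A \<in> frames ?k W" and "B \<in> frames 1 (h W)"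
    then have "vec.span {B 0} = vec.span {c A}" by (simp add: frames_1_iff c(3)[OF W])
    then obtain t where "t \<noteq> 0" "B 0 = t *s c A" by (rule span_singleton_eq_iff[OF _ c(1)[OF W]])
    then show "\<exists>\<phi> d. (\<phi>, d) \<in> {(\<lambda>A i. t *s c A, \<lambda>_. 1 :: complex) | t. t \<noteq> 0} \<and> d A \<noteq> 0 \<and> (\<forall>i<1. \<phi> A i = B i)"
      by (intro exI[of _ "\<lambda>A i. t *s c A"] exI[of _ "\<lambda>_. 1"]) auto
  next
    fix W assume "W \<in> ?X"
    then show "frames 1 (h W) \<noteq> {}" using frames_exist[OF hY] by blast
  qed (use hY frX in auto)
  moreover have "gr_morphism 1 ?k ?Y ?X h'"
  proof -
    define \<psi> where "\<psi> = (\<lambda>j (B :: nat \<Rightarrow> complex^'q) l.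
      B 0 $ j *s (P *v axis (e j l) 1) - B 0 $ (e j l) *s (P *v axis j 1))"
    \<comment> \<open>The lift \<open>\<psi> j\<close> is valid where coordinate \<open>j\<close> is nonzero; recombination reaches all other frames.\<close>
    define \<Phi> where "\<Phi> = {(\<lambda>B. recombine ?k g (\<psi> j B), \<lambda>B :: nat \<Rightarrow> complex^'q. B 0 $ j) | j g.
      \<forall>C :: nat \<Rightarrow> complex^'c. vec.span (recombine ?k g C ` {..<?k}) = vec.span (C ` {..<?k})}"
    have frame: "\<psi> j B \<in> frames ?k (h' p)" if "p \<in> ?Y" "B \<in> frames 1 p" "B 0 $ j \<noteq> 0" for p B j
    proof -
      have "h' p = (*v) P ` {z. pairing (B 0) z = 0}"
        using that(2) h'_span[of "B 0"] by (simp add: frames_1_iff)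
      then show ?thesis
        using hyperplane_frame[OF that(3) e, of P] by (simp add: frames_def \<psi>_def)
    qed
    show ?thesis
    proof (rule gr_morphismI[where \<Phi> = \<Phi>])
      fix \<phi> d i and j :: 'c assume "(\<phi>, d) \<in> \<Phi>"
      then obtain l g where \<phi>: "\<phi> = (\<lambda>B. recombine ?k g (\<psi> l B))" "d = (\<lambda>B. B 0 $ l)"
        unfolding \<Phi>_def by blast
      have coord: "(\<lambda>B. B 0 $ j) \<in> poly_funs (frame_coords 1)" for j :: 'q
        by (intro poly_funs.coord) (auto simp: frame_coords_def)
      then show "d \<in> poly_funs (frame_coords 1)" by (simp add: \<phi>(2))
      show "(\<lambda>A. \<phi> A i $ j) \<in> poly_funs (frame_coords 1)"
        unfolding \<phi>(1) recombine_def \<psi>_def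
        by (auto intro!: poly_funs_sum poly_funs_diff poly_funs.mult poly_funs.const coord[simplified])
    next
      fix \<phi> d p B assume \<phi>: "(\<phi>, d) \<in> \<Phi>" and p: "p \<in> ?Y" "B \<in> frames 1 p" "d B \<noteq> 0"
      then obtain l g where \<phi>: "\<phi> = (\<lambda>B. recombine ?k g (\<psi> l B))" "d = (\<lambda>B. B 0 $ l)"
        "\<And>C :: nat \<Rightarrow> complex^'c. vec.span (recombine ?k g C ` {..<?k}) = vec.span (C ` {..<?k})"
        unfolding \<Phi>_def by blast
      show "\<phi> B \<in> frames ?k (h' p)"
        using frame[OF p(1,2), of l] p(3) \<phi> by (simp add: frames_def)
    next
      fix p B A assume p: "p \<in> ?Y" "B \<in> frames 1 p" and A: "A \<in> frames ?k (h' p)"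
      have "B 0 \<noteq> 0" using p by (auto simp: frames_1_iff Gr_def)
      then obtain j where j: "B 0 $ j \<noteq> 0" by (metis vec_eq_iff zero_index)
      have "h' p \<in> Gr ?k" using h'X[OF p(1)] by simp
      then obtain g where g: "\<And>C :: nat \<Rightarrow> complex^'c. vec.span (recombine ?k g C ` {..<?k}) = vec.span (C ` {..<?k})"
        "\<And>i. i < ?k \<Longrightarrow> recombine ?k g (\<psi> j B) i = A i"
        using frames_transitive[OF _ frame[OF p j] A] by blast
      have "(\<lambda>B. recombine ?k g (\<psi> j B), \<lambda>B. B 0 $ j) \<in> \<Phi>" unfolding \<Phi>_def using g(1) by blast
      with g(2) j show "\<exists>\<phi> d. (\<phi>, d) \<in> \<Phi> \<and> d B \<noteq> 0 \<and> (\<forall>i<?k. \<phi> B i = A i)" by blast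
    next
      fix p assume p: "p \<in> ?Y"
      show "frames 1 p \<noteq> {}" using frames_exist[OF p] by blast
      show "frames ?k (h' p) \<noteq> {}" using h'X[OF p] frX by blast
      show "h' p \<in> ?X" by (rule h'X[OF p])
    qed
  qed
  ultimately show ?thesis unfolding gr_isomorphic_def using inv1 inv2 by blast
qed

section \<open>Fibres, kernels and lines\<close>

lemma omega_contraction: "omega M a u b = pairing (contraction M a u) b"
proof -
  have "omega M a u b = (\<Sum>i\<in>UNIV. \<Sum>j\<in>UNIV. \<Sum>k\<in>UNIV. a $ i * u $ k * M $ i $ j $ k * b $ j)"
    unfolding omega_def value_at_def matrix_vector_mult_def
    by (simp add: sum_distrib_left sum_distrib_right mult_ac)
  also have "\<dots> = (\<Sum>j\<in>UNIV. \<Sum>i\<in>UNIV. \<Sum>k\<in>UNIV. a $ i * u $ k * M $ i $ j $ k * b $ j)"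
    by (rule sum.swap)
  also have "\<dots> = pairing (contraction M a u) b"
    unfolding pairing_def contraction_def vec_lambda_beta sum_distrib_right UNIV_Times_UNIV[symmetric]
      sum.cartesian_product[symmetric] by simp
  finally show ?thesis .
qed

lemma transpose_value_at: "transpose (value_at M u) *v a = contraction M a u"
  unfolding contraction_def UNIV_Times_UNIV[symmetric] sum.cartesian_product[symmetric]
  by (simp add: vec_eq_iff transpose_def value_at_def matrix_vector_mult_def sum_distrib_left
      sum_distrib_right mult_ac)

text \<open>
  Row rank less than the number of rows means a linear relation between the rows, that is, a vector
  in the kernel of the transpose.
\<close>

lemma rank_le_iff_kernel:
  fixes A :: "complex^'c::finite^'n::finite"
  shows "rank A \<le> CARD('n) - 1 \<longleftrightarrow> (\<exists>a. a \<noteq> 0 \<and> transpose A *v a = 0)"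
proof
  assume "rank A \<le> CARD('n) - 1"
  moreover have "CARD('n) > 0" by simp
  ultimately have less: "rank A < CARD('n)" by linarith
  show "\<exists>a. a \<noteq> 0 \<and> transpose A *v a = 0"
  proof (rule ccontr)
    assume "\<nexists>a. a \<noteq> 0 \<and> transpose A *v a = 0"
    then have "inj ((*v) (transpose A))" using vec.inj_iff_eq_0 by blast
    then have "vec.dim (range ((*v) (transpose A))) = CARD('n)"
      by (subst vec.dim_image_eq[OF matrix_vector_mul_linear_gen]) (auto simp: card_cart_basis)
    moreover have "range ((*v) (transpose A)) \<subseteq> vec.span (rows A)"
    proof clarify
      fix a
      have "transpose A *v a = (\<Sum>i\<in>UNIV. a $ i *s row i A)"
        by (simp add: vec_eq_iff matrix_vector_mult_def transpose_def row_def mult.commute)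
      also have "\<dots> \<in> vec.span (rows A)"
        by (intro vec.span_sum vec.span_scale vec.span_base) (auto simp: rows_def)
      finally show "transpose A *v a \<in> vec.span (rows A)" .
    qed
    ultimately show False using less vec.dim_mono[of "range ((*v) (transpose A))" "rows A"]
      by (simp add: row_rank_def_gen)
  qed
next
  assume "\<exists>a. a \<noteq> 0 \<and> transpose A *v a = 0"
  then obtain a where a: "a \<noteq> 0" "transpose A *v a = 0" by blast
  then obtain i where i: "a $ i \<noteq> 0" by (metis vec_eq_iff zero_index)
  let ?B = "(\<lambda>r. row r A) ` (UNIV - {i})"
  have "row i A = (\<Sum>r\<in>UNIV - {i}. (- (a $ r / a $ i)) *s row r A)"
  proof -
    have "row i A $ j = (\<Sum>r\<in>UNIV - {i}. (- (a $ r / a $ i)) *s row r A) $ j" for j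
    proof -
      have "0 = (\<Sum>r\<in>UNIV. a $ r * A $ r $ j)"
        using arg_cong[OF a(2), of "\<lambda>v. v $ j"]
        by (simp add: matrix_vector_mult_def transpose_def mult.commute)
      also have "\<dots> = a $ i * A $ i $ j + (\<Sum>r\<in>UNIV - {i}. a $ r * A $ r $ j)"
        by (rule sum.remove) auto
      finally have "A $ i $ j = - (\<Sum>r\<in>UNIV - {i}. a $ r * A $ r $ j) / a $ i"
        using i by (simp add: field_simps eq_neg_iff_add_eq_0)
      then show ?thesis by (simp add: row_def sum_negf sum_divide_distrib)
    qed
    then show ?thesis unfolding vec_eq_iff by blast
  qed
  also have "\<dots> \<in> vec.span ?B"
    by (intro vec.span_sum vec.span_scale vec.span_base) auto
  finally have "row i A \<in> vec.span ?B" .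
  then have "rows A \<subseteq> vec.span ?B"
    by (auto simp: rows_def intro: vec.span_base)
  then have "rank A \<le> card ?B" unfolding row_rank_def_gen by (rule vec.dim_le_card) simp
  also have "\<dots> \<le> card (UNIV - {i})" by (rule card_image_le) simp
  finally show "rank A \<le> CARD('n) - 1" by (simp add: card_Diff_singleton)
qed

lemma rank_value_at_le_iff:
  "rank (value_at M u) \<le> CARD('n) - 1 \<longleftrightarrow> (\<exists>a. a \<noteq> 0 \<and> contraction M a u = 0)"
  for M :: "complex^'v::finite^'c::finite^'n::finite"
  unfolding rank_le_iff_kernel transpose_value_at ..

lemma span_pair_in_Gr_2:
  fixes a b :: "complex^'d::finite"
  assumes "b \<noteq> 0" "a \<notin> vec.span {b}"
  shows "vec.span {a, b} \<in> Gr 2"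
  using assms by (simp add: Gr_def vec.dim_insert)

lemma in_span_pair: "v \<in> vec.span {a, b} \<longleftrightarrow> (\<exists>x y. v = x *s a + y *s b)"
  for a b :: "complex^'d::finite"
proof
  assume "v \<in> vec.span {a, b}"
  then obtain k where "v - k *s a \<in> vec.span {b}" unfolding vec.span_insert[of a] by blast
  then obtain l where "v - k *s a = l *s b" unfolding vec.span_singleton by blast
  then have "v = k *s a + l *s b" by (simp add: diff_eq_eq add.commute)
  then show "\<exists>x y. v = x *s a + y *s b" by blast
next
  assume "\<exists>x y. v = x *s a + y *s b"
  then show "v \<in> vec.span {a, b}" by (auto intro!: vec.span_add vec.span_scale intro: vec.span_base)
qed

text \<open>
  The rank of \<open>M\<^sub>u\<close> is at least \<open>n - 1\<close> for all \<open>u \<noteq> 0\<close>, stated by means of the left kernel. Under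
  this condition \<open>psi\<close> is defined on the whole degeneracy locus.
\<close>

definition corank_le_one :: "complex^'v^'c^'n \<Rightarrow> bool" where
  "corank_le_one M \<longleftrightarrow> (\<forall>u W. u \<noteq> 0 \<longrightarrow> W \<in> Gr 2 \<longrightarrow> (\<exists>a\<in>W. contraction M a u \<noteq> 0))"

lemma kernel_unique:
  fixes M :: "complex^'v::finite^'c::finite^'n::finite"
  assumes nondeg: "corank_le_one M"
    and "u \<noteq> 0" "b \<noteq> 0" "contraction M a u = 0" "contraction M b u = 0"
  shows "a \<in> vec.span {b}"
proof (rule ccontr)
  assume "a \<notin> vec.span {b}"
  then have "vec.span {a, b} \<in> Gr 2" using assms(3) by (intro span_pair_in_Gr_2)
  then obtain c where "c \<in> vec.span {a, b}" "contraction M c u \<noteq> 0" using nondeg assms(2) unfolding corank_le_one_def by blast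
  then show False
    using assms(4,5) by (auto simp: in_span_pair contraction_add_left contraction_scale_left)
qed

lemma psi_span:
  fixes M :: "complex^'v::finite^'c::finite^'n::finite"
  assumes nondeg: "corank_le_one M"
    and u: "u \<noteq> 0" and a: "a \<noteq> 0" "contraction M a u = 0"
  shows "psi M (vec.span {u}) = vec.span {a}"
  unfolding psi_def transpose_value_at
proof (rule the_equality)
  have "vec.span {a} \<in> proj_space" using a(1) unfolding Gr_1_iff by blast
  then show "vec.span {a} \<in> proj_space \<and> (\<forall>v\<in>vec.span {u}. \<forall>\<alpha>\<in>vec.span {a}. contraction M \<alpha> v = 0)"
    using a(2) by (auto simp: vec.span_singleton contraction_scale_left contraction_scale_right)
next
  fix q assume q: "q \<in> proj_space \<and> (\<forall>v\<in>vec.span {u}. \<forall>\<alpha>\<in>q. contraction M \<alpha> v = 0)"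
  then obtain b where b: "b \<noteq> 0" "q = vec.span {b}" unfolding Gr_1_iff by blast
  have "u \<in> vec.span {u}" "b \<in> q" by (simp_all add: b(2) vec.span_base)
  with q have bu: "contraction M b u = 0" by blast
  have "b \<in> vec.span {a}" by (rule kernel_unique[OF nondeg u a(1) bu a(2)])
  then obtain t where t: "b = t *s a" by (auto simp: vec.span_singleton)
  with b(1) have "t \<noteq> 0" by auto
  then show "q = vec.span {a}" unfolding b(2) t by (rule span_singleton_scale)
qed

lemma fibre_eq:
  fixes M :: "complex^'v::finite^'c::finite^'n::finite"
  assumes "W\<^sub>1 \<in> Gr 2" "W\<^sub>2 \<in> Gr 2"
  shows "fibre M (W\<^sub>1, W\<^sub>2) =
    {W \<in> Gr (CARD('c) - 2). \<forall>a\<in>W\<^sub>1. \<forall>u\<in>W\<^sub>2. \<forall>b\<in>W. pairing (contraction M a u) b = 0}"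
  using assms by (auto simp: fibre_def zero_locus_def pr12_def omega_contraction image_iff)

text \<open>
  Two distinct subspaces of codimension 2 span a space of codimension at most 1. All contractions vanish
  on it, so it is the zero set of any nonzero contraction \<open>f\<close>, and the others are multiples of \<open>f\<close>.
\<close>

lemma two_points_rank_one:
  fixes M :: "complex^'v::finite^'c::finite^'n::finite"
  assumes W: "W\<^sub>1 \<in> Gr 2" "W\<^sub>2 \<in> Gr 2" and card: "CARD('c) \<ge> 2"
    and B: "B \<in> fibre M (W\<^sub>1, W\<^sub>2)" "B' \<in> fibre M (W\<^sub>1, W\<^sub>2)" "B \<noteq> B'"
  shows "\<exists>f. \<forall>a\<in>W\<^sub>1. \<forall>u\<in>W\<^sub>2. contraction M a u \<in> vec.span {f}"
proof (cases "\<forall>a\<in>W\<^sub>1. \<forall>u\<in>W\<^sub>2. contraction M a u = 0")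
  case True
  then show ?thesis by (intro exI[of _ 0]) simp
next
  case False
  then obtain a\<^sub>0 u\<^sub>0 where a\<^sub>0: "a\<^sub>0 \<in> W\<^sub>1" "u\<^sub>0 \<in> W\<^sub>2" and nz: "contraction M a\<^sub>0 u\<^sub>0 \<noteq> 0" by blast
  define f where "f = contraction M a\<^sub>0 u\<^sub>0"
  have B': "vec.subspace B" "vec.dim B = CARD('c) - 2" "vec.subspace B'" "vec.dim B' = CARD('c) - 2"
    using B by (auto simp: fibre_eq[OF W] Gr_def)
  obtain b where b: "b \<in> B'" "b \<notin> B"
    using vec.subspace_dim_equal[OF B'(3,1)] B' B(3) by auto
  have sub: "insert b B \<subseteq> {z. pairing (contraction M a u) z = 0}" if "a \<in> W\<^sub>1" "u \<in> W\<^sub>2" for a u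
    using B b(1) that unfolding fibre_eq[OF W] by auto
  have "vec.dim (vec.span (insert b B)) = CARD('c) - 1"
    using b(2) B'(1,2) card by (simp add: vec.dim_insert vec.span_eq_iff[THEN iffD2])
  moreover have span: "vec.span (insert b B) \<subseteq> {z. pairing (contraction M a u) z = 0}"
    if "a \<in> W\<^sub>1" "u \<in> W\<^sub>2" for a u
    by (rule vec.span_minimal[OF sub[OF that] subspace_hyperplane])
  moreover have "vec.dim {z. pairing f z = 0} + 1 = CARD('c)"
    using nz by (intro dim_hyperplane) (simp add: f_def)
  ultimately have eq: "vec.span (insert b B) = {z. pairing f z = 0}"
    using a\<^sub>0 unfolding f_def by (intro vec.subspace_dim_equal subspace_hyperplane) auto
  have "contraction M a u \<in> vec.span {f}" if "a \<in> W\<^sub>1" "u \<in> W\<^sub>2" for a u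
  proof -
    have "contraction M a u \<in> annihilator {z. pairing f z = 0}"
      using span[OF that] unfolding eq by (auto simp: annihilator_def)
    then show ?thesis using annihilator_hyperplane[of f] nz by (simp add: f_def)
  qed
  then show ?thesis by blast
qed

lemma fibre_rank_one:
  fixes M :: "complex^'v::finite^'c::finite^'n::finite"
  assumes W: "W\<^sub>1 \<in> Gr 2" "W\<^sub>2 \<in> Gr 2"
    and f: "a \<in> W\<^sub>1" "u \<in> W\<^sub>2" "f = contraction M a u"
    and span: "\<forall>a\<in>W\<^sub>1. \<forall>u\<in>W\<^sub>2. contraction M a u \<in> vec.span {f}"
  shows "fibre M (W\<^sub>1, W\<^sub>2) = {W \<in> Gr (CARD('c) - 2). W \<subseteq> {b. pairing f b = 0}}"
proof -
  have "pairing (contraction M c w) b = 0" if "c \<in> W\<^sub>1" "w \<in> W\<^sub>2" "pairing f b = 0" for c w b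
    using span[rule_format, OF that(1,2)] that(3) by (auto simp: vec.span_singleton)
  then show ?thesis unfolding fibre_eq[OF W] using f(1,2) unfolding f(3) by blast
qed

lemma linear_equation_two_unknowns:
  fixes A B :: complex
  obtains s t where "s * A + t * B = 0" "s \<noteq> 0 \<or> t \<noteq> 0"
proof (cases "A = 0 \<and> B = 0")
  case True
  then show thesis using that[of 1 0] by simp
next
  case False
  then show thesis using that[of B "- A"] by auto
qed

text \<open>
  Here \<open>contraction M c w = l c w *s f\<close> with a bilinear form \<open>l\<close> on \<open>W\<^sub>1 \<times> W\<^sub>2\<close>. Fixing \<open>w\<close>, the equation
  \<open>l c w = 0\<close> is one equation on a plane and has a solution \<open>c \<noteq> 0\<close>, so the line of \<open>W\<^sub>2\<close> lies in the
  degeneracy locus and is mapped into the line of \<open>W\<^sub>1\<close>. Fixing \<open>c\<close> shows that the map is onto.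
\<close>

lemma line_of_rank_one:
  fixes M :: "complex^'v::finite^'c::finite^'n::finite"
  assumes nondeg: "corank_le_one M"
    and W: "W\<^sub>1 \<in> Gr 2" "W\<^sub>2 \<in> Gr 2"
    and span: "\<forall>a\<in>W\<^sub>1. \<forall>u\<in>W\<^sub>2. contraction M a u \<in> vec.span {f}"
  shows "\<exists>L. is_line L \<and> L \<subseteq> degeneracy_locus (CARD('n) - 1) M \<and> is_line (psi M ` L)"
proof -
  obtain a b where ab: "a \<in> W\<^sub>1" "b \<in> W\<^sub>1" "W\<^sub>1 = vec.span {a, b}"
    "\<And>x y. x *s a + y *s b = 0 \<Longrightarrow> x = 0 \<and> y = 0"
    using Gr2_basis[OF W(1)] by metis
  obtain u v where uv: "u \<in> W\<^sub>2" "v \<in> W\<^sub>2" "W\<^sub>2 = vec.span {u, v}"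
    "\<And>x y. x *s u + y *s v = 0 \<Longrightarrow> x = 0 \<and> y = 0"
    using Gr2_basis[OF W(2)] by metis
  have "\<exists>l. contraction M c w = l *s f" if "c \<in> W\<^sub>1" "w \<in> W\<^sub>2" for c w
    using span[rule_format, OF that] by (auto simp: vec.span_singleton)
  then obtain l where l: "\<And>c w. c \<in> W\<^sub>1 \<Longrightarrow> w \<in> W\<^sub>2 \<Longrightarrow> contraction M c w = l c w *s f" by metis
  have sub1: "x *s a + y *s b \<in> W\<^sub>1" for x y unfolding ab(3) in_span_pair by blast
  have sub2: "x *s u + y *s v \<in> W\<^sub>2" for x y unfolding uv(3) in_span_pair by blast
  have left: "\<exists>c\<in>W\<^sub>1. c \<noteq> 0 \<and> contraction M c w = 0" if w: "w \<in> W\<^sub>2" for w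
  proof -
    obtain s t where st: "s * l a w + t * l b w = 0" "s \<noteq> 0 \<or> t \<noteq> 0"
      by (rule linear_equation_two_unknowns)
    have "contraction M (s *s a + t *s b) w = (s * l a w + t * l b w) *s f"
      by (simp add: contraction_add_left contraction_scale_left l ab(1,2) w vec.scale_left_distrib)
    then show ?thesis using st ab(4)[of s t] sub1[of s t] by (intro bexI[of _ "s *s a + t *s b"]) auto
  qed
  have right: "\<exists>w\<in>W\<^sub>2. w \<noteq> 0 \<and> contraction M c w = 0" if c: "c \<in> W\<^sub>1" for c
  proof -
    obtain s t where st: "s * l c u + t * l c v = 0" "s \<noteq> 0 \<or> t \<noteq> 0"
      by (rule linear_equation_two_unknowns)
    have "contraction M c (s *s u + t *s v) = (s * l c u + t * l c v) *s f"
      by (simp add: contraction_add_right contraction_scale_right l uv(1,2) c vec.scale_left_distrib)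
    then show ?thesis using st uv(4)[of s t] sub2[of s t] by (intro bexI[of _ "s *s u + t *s v"]) auto
  qed
  have spanW: "vec.span {w} \<subseteq> W \<longleftrightarrow> w \<in> W" if "W \<in> Gr 2" for w and W :: "(complex^'d::finite) set"
    using that vec.span_minimal[of "{w}" W] vec.span_base[of w "{w}"] by (auto simp: Gr_def)
  define L where "L = {p \<in> proj_space. p \<subseteq> W\<^sub>2}"
  have "p \<in> degeneracy_locus (CARD('n) - 1) M \<and> psi M p \<in> {q \<in> proj_space. q \<subseteq> W\<^sub>1}" if p: "p \<in> L" for p
  proof -
    from p obtain w where w: "w \<noteq> 0" "p = vec.span {w}" unfolding L_def Gr_1_iff by blast
    then have "w \<in> W\<^sub>2" using p vec.span_base[of w "{w}"] unfolding L_def by blast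
    then obtain c where c: "c \<in> W\<^sub>1" "c \<noteq> 0" "contraction M c w = 0" using left by blast
    have "contraction M c v = 0" if "v \<in> p" for v
      using that c(3) by (auto simp: w(2) vec.span_singleton contraction_scale_right)
    then have "p \<in> degeneracy_locus (CARD('n) - 1) M"
      using p c(2) by (auto simp: degeneracy_locus_def L_def rank_value_at_le_iff[unfolded One_nat_def])
    moreover have "psi M p = vec.span {c}" unfolding w(2) by (rule psi_span[OF nondeg w(1) c(2,3)])
    moreover have "vec.span {c} \<in> proj_space" using c(2) unfolding Gr_1_iff by blast
    moreover have "vec.span {c} \<subseteq> W\<^sub>1" using c(1) spanW[OF W(1)] by simp
    ultimately show ?thesis by simp
  qed
  moreover have "q \<in> psi M ` L" if q: "q \<in> proj_space" "q \<subseteq> W\<^sub>1" for q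
  proof -
    from q obtain c where c: "c \<noteq> 0" "q = vec.span {c}" unfolding Gr_1_iff by blast
    then have "c \<in> W\<^sub>1" using q vec.span_base[of c "{c}"] by blast
    then obtain w where w: "w \<in> W\<^sub>2" "w \<noteq> 0" "contraction M c w = 0" using right by blast
    have "vec.span {w} \<in> L"
      using w(1,2) spanW[OF W(2)] unfolding L_def Gr_1_iff by blast
    moreover have "psi M (vec.span {w}) = q" unfolding c(2) by (rule psi_span[OF nondeg w(2) c(1) w(3)])
    ultimately show ?thesis by blast
  qed
  ultimately have "L \<subseteq> degeneracy_locus (CARD('n) - 1) M" "psi M ` L = {q \<in> proj_space. q \<subseteq> W\<^sub>1}" by blast+
  then show ?thesis using W unfolding is_line_def L_def by blast
qed

text \<open>
  Every \<open>c \<in> W\<^sub>1\<close> is a kernel vector for some \<open>w \<in> W\<^sub>2\<close>. Apply this to a basis \<open>a\<close>, \<open>b\<close> of \<open>W\<^sub>1\<close> and to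
  \<open>a + b\<close>, and write \<open>F\<close> for the contraction. This gives \<open>u\<close>, \<open>v\<close> and \<open>w = y v + x u\<close> with
  \<open>F a u = 0\<close>, \<open>F b v = 0\<close> and \<open>0 = F (a + b) w = y F a v + x F b u\<close>. The vectors \<open>u\<close> and \<open>v\<close>
  span \<open>W\<^sub>2\<close>, since otherwise both \<open>a\<close> and \<open>b\<close> would be in the kernel at \<open>v\<close>, and \<open>x \<noteq> 0\<close> for a similar
  reason. So all contractions are multiples of \<open>F a v\<close>, which is not zero by the bound on the corank.
\<close>

lemma rank_one_of_line:
  fixes M :: "complex^'v::finite^'c::finite^'n::finite"
  assumes nondeg: "corank_le_one M"
    and L: "is_line L" "L \<subseteq> degeneracy_locus (CARD('n) - 1) M" "is_line (psi M ` L)"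
  obtains W\<^sub>1 W\<^sub>2 a u where "W\<^sub>1 \<in> Gr 2" "W\<^sub>2 \<in> Gr 2" "a \<in> W\<^sub>1" "u \<in> W\<^sub>2" "contraction M a u \<noteq> 0"
    "\<forall>c\<in>W\<^sub>1. \<forall>w\<in>W\<^sub>2. contraction M c w \<in> vec.span {contraction M a u}"
proof -
  obtain W\<^sub>2 where W2: "W\<^sub>2 \<in> Gr 2" "L = {p \<in> proj_space. p \<subseteq> W\<^sub>2}" using L(1) unfolding is_line_def by (elim bexE) (rule that)
  obtain W\<^sub>1 where W1: "W\<^sub>1 \<in> Gr 2" "psi M ` L = {p \<in> proj_space. p \<subseteq> W\<^sub>1}" using L(3) unfolding is_line_def by (elim bexE) (rule that)
  have right: "\<exists>w\<in>W\<^sub>2. w \<noteq> 0 \<and> contraction M c w = 0" if c: "c \<in> W\<^sub>1" "c \<noteq> 0" for c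
  proof -
    have "vec.span {c} \<in> proj_space" using c(2) unfolding Gr_1_iff by blast
    moreover have "vec.span {c} \<subseteq> W\<^sub>1"
      using W1(1) c(1) by (intro vec.span_minimal) (auto simp: Gr_def)
    ultimately have "vec.span {c} \<in> psi M ` L" unfolding W1(2) by blast
    then obtain p where p: "p \<in> L" "psi M p = vec.span {c}" by auto
    then obtain w where w: "w \<noteq> 0" "p = vec.span {w}" unfolding W2(2) Gr_1_iff by blast
    have wp: "w \<in> p" unfolding w(2) by (rule vec.span_base) simp
    then have "rank (value_at M w) \<le> CARD('n) - 1" using p(1) L(2) unfolding degeneracy_locus_def by blast
    then obtain d where d: "d \<noteq> 0" "contraction M d w = 0" unfolding rank_value_at_le_iff by blast
    have "vec.span {c} = vec.span {d}" using psi_span[OF nondeg w(1) d] p(2) w(2) by simp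
    then have "c \<in> vec.span {d}" using vec.span_base[of c "{c}"] by blast
    then have "contraction M c w = 0" using d(2) by (auto simp: vec.span_singleton contraction_scale_left)
    moreover have "w \<in> W\<^sub>2" using wp p(1) W2(2) by blast
    ultimately show ?thesis using w(1) by blast
  qed
  obtain a b where ab: "a \<in> W\<^sub>1" "b \<in> W\<^sub>1" "W\<^sub>1 = vec.span {a, b}"
    "\<And>x y. x *s a + y *s b = 0 \<Longrightarrow> x = 0 \<and> y = 0"
    using Gr2_basis[OF W1(1)] by metis
  have nz: "a \<noteq> 0" "b \<noteq> 0" "a + b \<noteq> 0" using ab(4)[of 1 0] ab(4)[of 0 1] ab(4)[of 1 1] by auto
  have "a + b \<in> W\<^sub>1" using W1(1) ab(1,2) by (auto simp: Gr_def intro: vec.subspace_add)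
  then obtain u v w where u: "u \<in> W\<^sub>2" "u \<noteq> 0" "contraction M a u = 0"
    and v: "v \<in> W\<^sub>2" "v \<noteq> 0" "contraction M b v = 0"
    and w: "w \<in> W\<^sub>2" "w \<noteq> 0" "contraction M (a + b) w = 0"
    using right[OF ab(1) nz(1)] right[OF ab(2) nz(2)] right[OF _ nz(3)] by blast
  have indep: False if "contraction M a x = 0" "contraction M b x = 0" "x \<noteq> 0" for x
  proof -
    have "a \<in> vec.span {b}" by (rule kernel_unique[OF nondeg that(3) nz(2) that(1,2)])
    then obtain t where "a = t *s b" by (auto simp: vec.span_singleton)
    then have "1 *s a + (- t) *s b = 0" by simp
    from ab(4)[OF this] show False by simp
  qed
  have "v \<notin> vec.span {u}"
  proof
    assume "v \<in> vec.span {u}"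
    then have "contraction M a v = 0" using u(3) by (auto simp: vec.span_singleton contraction_scale_right)
    then show False using indep v(2,3) by blast
  qed
  then have "vec.span {v, u} \<in> Gr 2" using u(2) by (intro span_pair_in_Gr_2)
  moreover have "vec.span {v, u} \<subseteq> W\<^sub>2"
    using W2(1) u(1) v(1) by (intro vec.span_minimal) (auto simp: Gr_def)
  ultimately have span2: "vec.span {v, u} = W\<^sub>2"
    using W2(1) by (intro vec.subspace_dim_equal) (auto simp: Gr_def)
  define f where "f = contraction M a v"
  have f: "f \<noteq> 0" unfolding f_def using indep v(2,3) by blast
  obtain y x where yx: "w = y *s v + x *s u" using w(1) unfolding span2[symmetric] in_span_pair by blast
  have rel: "y *s f + x *s contraction M b u = 0"
    using w(3) by (simp add: yx contraction_add_left contraction_add_right contraction_scale_right u(3) v(3) f_def)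
  have "x \<noteq> 0"
  proof
    assume "x = 0"
    with rel f have "y = 0" by simp
    with \<open>x = 0\<close> yx w(2) show False by simp
  qed
  have bu: "contraction M b u = (- y / x) *s f"
  proof -
    have "contraction M b u $ j = ((- y / x) *s f) $ j" for j
    proof -
      have "y * f $ j + x * contraction M b u $ j = 0" using arg_cong[OF rel, of "\<lambda>v. v $ j"] by simp
      then have "x * contraction M b u $ j = - (y * f $ j)" by (simp add: eq_neg_iff_add_eq_0 add.commute)
      then show ?thesis using \<open>x \<noteq> 0\<close> by (simp add: field_simps)
    qed
    then show ?thesis unfolding vec_eq_iff by blast
  qed
  have "contraction M c z \<in> vec.span {f}" if c: "c \<in> W\<^sub>1" and z: "z \<in> W\<^sub>2" for c z
  proof -
    obtain c\<^sub>0 c\<^sub>1 where c': "c = c\<^sub>0 *s a + c\<^sub>1 *s b" using c unfolding ab(3) in_span_pair by blast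
    obtain z\<^sub>0 z\<^sub>1 where z': "z = z\<^sub>0 *s v + z\<^sub>1 *s u" using z unfolding span2[symmetric] in_span_pair by blast
    have eq: "contraction M c z = (c\<^sub>0 * z\<^sub>0) *s f + (c\<^sub>1 * z\<^sub>1) *s contraction M b u"
      by (simp add: c' z' contraction_add_left contraction_add_right contraction_scale_left
          contraction_scale_right u(3) v(3) f_def mult.commute)
    show ?thesis unfolding eq bu by (intro vec.span_add vec.span_scale vec.span_base) simp_all
  qed
  then show thesis using that[OF W1(1) W2(1) ab(1) v(1)] f unfolding f_def by blast
qed

theorem theorem5p3:
  fixes n m s :: nat
  assumes "n \<ge> 3" and "s \<in> {m + 2..2 * m + 3}"
    and "CARD('n::finite) = n" and "CARD('v::finite) = s + 1" and "CARD('c::finite) = n + m"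
    and "CARD('q::finite) = n + m - 1"
  shows "\<exists>U :: (complex^'v^'c^'n) set. zariski_open form_matrix_coords U \<and> U \<noteq> {} \<and>
    (\<forall>M \<in> U.
      (int n > 2 * int s - 3 * int m - 1 \<longrightarrow> inj_on pr12 (zero_locus M)) \<and>
      ((\<exists>L. is_line L \<and> L \<subseteq> degeneracy_locus (n - 1) M \<and> is_line (psi M ` L)) \<longleftrightarrow>
       (\<exists>y \<in> Gr 2 \<times> Gr 2.
          gr_isomorphic (n + m - 2) 1 (fibre M y) (proj_space :: (complex^'q) set set))))"
proof -
  define big where "big \<longleftrightarrow> int n > 2 * int s - 3 * int m - 1"
  \<comment> \<open>Condition (1) is only claimed in a certain range, so \<open>Bad\<^sub>2\<close> is empty outside of it.\<close>
  define Bad\<^sub>1 where "Bad\<^sub>1 = {M :: complex^'v^'c^'n.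
    \<exists>u W. u \<noteq> 0 \<and> W \<in> Gr 2 \<and> (\<forall>a\<in>W. contraction M a u = 0)}"
  define Bad\<^sub>2 where "Bad\<^sub>2 = {M :: complex^'v^'c^'n. big \<and>
    (\<exists>W\<^sub>1\<in>Gr 2. \<exists>W\<^sub>2\<in>Gr 2. \<exists>f. \<forall>a\<in>W\<^sub>1. \<forall>u\<in>W\<^sub>2. contraction M a u \<in> vec.span {f})}"
  have "thin form_matrix_coords Bad\<^sub>1"
    unfolding Bad\<^sub>1_def using assms by (intro thin_corank_two) auto
  moreover have "thin form_matrix_coords Bad\<^sub>2"
  proof (cases big)
    case True
    then have "2 * CARD('n) + 2 * CARD('v) < 3 * CARD('c) + 5" using assms by (simp add: big_def)
    from thin_rank_one[OF this] show ?thesis by (rule thin_subset) (auto simp: Bad\<^sub>2_def)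
  next
    case False
    then have "Bad\<^sub>2 \<subseteq> Bad\<^sub>1" by (auto simp: Bad\<^sub>2_def)
    with calculation show ?thesis by (rule thin_subset)
  qed
  ultimately have "thin form_matrix_coords (Bad\<^sub>1 \<union> Bad\<^sub>2)" by (rule thin_Un)
  from thin_avoided_by_open[OF this] obtain U where
    U: "zariski_open form_matrix_coords U" "U \<noteq> {}" "U \<inter> (Bad\<^sub>1 \<union> Bad\<^sub>2) = {}" by blast
  have inj: "inj_on pr12 (zero_locus M)" if M: "M \<in> U" and big for M
  proof (rule inj_onI)
    fix z z' assume z: "z \<in> zero_locus M" "z' \<in> zero_locus M" "pr12 z = pr12 z'"
    obtain W\<^sub>1 W\<^sub>2 B B' where zz: "z = (W\<^sub>1, W\<^sub>2, B)" "z' = (W\<^sub>1, W\<^sub>2, B')"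
      using z(3) by (cases z; cases z') (auto simp: pr12_def)
    have W: "W\<^sub>1 \<in> Gr 2" "W\<^sub>2 \<in> Gr 2" using z(1) by (auto simp: zz zero_locus_def)
    have fib: "C \<in> fibre M (W\<^sub>1, W\<^sub>2)" if "(W\<^sub>1, W\<^sub>2, C) \<in> zero_locus M" for C
      unfolding fibre_def using that by (intro image_eqI[of _ _ "(W\<^sub>1, W\<^sub>2, C)"]) (simp_all add: pr12_def)
    have BB': "B \<in> fibre M (W\<^sub>1, W\<^sub>2)" "B' \<in> fibre M (W\<^sub>1, W\<^sub>2)" using z(1,2) unfolding zz by (simp_all add: fib)
    have card: "CARD('c) \<ge> 2" using assms by simp
    have "B = B'"
    proof (rule ccontr)
      assume "B \<noteq> B'"
      from two_points_rank_one[OF W card BB' this] W \<open>big\<close> have "M \<in> Bad\<^sub>2"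
        unfolding Bad\<^sub>2_def mem_Collect_eq by (intro conjI bexI)
      with M U(3) show False by blast
    qed
    then show "z = z'" by (simp add: zz)
  qed
  have equiv: "(\<exists>L. is_line L \<and> L \<subseteq> degeneracy_locus (n - 1) M \<and> is_line (psi M ` L)) \<longleftrightarrow>
       (\<exists>y \<in> Gr 2 \<times> Gr 2.
          gr_isomorphic (n + m - 2) 1 (fibre M y) (proj_space :: (complex^'q) set set))"
    (is "?line \<longleftrightarrow> ?fibre") if M: "M \<in> U" for M
  proof -
    have nondeg: "corank_le_one M"
      using M U(3) unfolding Bad\<^sub>1_def corank_le_one_def by blast
    show ?thesis
    proof
      assume ?line
      then obtain L where L: "is_line L" "L \<subseteq> degeneracy_locus (CARD('n) - 1) M" "is_line (psi M ` L)"
        using assms(3) by auto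
      obtain W\<^sub>1 W\<^sub>2 a u where W: "W\<^sub>1 \<in> Gr 2" "W\<^sub>2 \<in> Gr 2" "a \<in> W\<^sub>1" "u \<in> W\<^sub>2" "contraction M a u \<noteq> 0"
        "\<forall>c\<in>W\<^sub>1. \<forall>w\<in>W\<^sub>2. contraction M c w \<in> vec.span {contraction M a u}"
        by (rule rank_one_of_line[OF nondeg L]) (rule that)
      have "CARD('q) + 1 = CARD('c)" using assms by simp
      from hyperplane_sections_isomorphic_proj_space[OF W(5) this]
      have "gr_isomorphic (CARD('c) - 2) 1 (fibre M (W\<^sub>1, W\<^sub>2)) (proj_space :: (complex^'q) set set)"
        unfolding fibre_rank_one[OF W(1,2,3,4) refl W(6)] .
      then show ?fibre using W(1,2) assms(5) by auto
    next
      assume ?fibre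
      then obtain W\<^sub>1 W\<^sub>2 where W: "W\<^sub>1 \<in> Gr 2" "W\<^sub>2 \<in> Gr 2"
        and iso: "gr_isomorphic (n + m - 2) 1 (fibre M (W\<^sub>1, W\<^sub>2)) (proj_space :: (complex^'q) set set)"
        by auto
      from iso obtain h h' where mor: "gr_morphism 1 (n + m - 2) (proj_space :: (complex^'q) set set) (fibre M (W\<^sub>1, W\<^sub>2)) h'"
        and hh: "\<forall>y \<in> (proj_space :: (complex^'q) set set). h (h' y) = y"
        unfolding gr_isomorphic_def by (elim exE conjE) (rule that)
      have h': "h' ` (proj_space :: (complex^'q) set set) \<subseteq> fibre M (W\<^sub>1, W\<^sub>2)"
        using mor unfolding gr_morphism_def by (rule conjunct1)
      have "\<not> CARD('q) \<le> Suc 0" using assms by simp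
      then obtain i j :: 'q where "i \<noteq> j" using card_le_Suc0_iff_eq[of "UNIV :: 'q set"] by auto
      \<comment> \<open>Two coordinate points of the projective space give two points of the fibre.\<close>
      define p where "p = (\<lambda>i :: 'q. vec.span {axis i (1 :: complex)})"
      have p: "p i \<in> proj_space" for i unfolding p_def Gr_1_iff by (metis axis_eq_0_iff one_neq_zero)
      have "p i \<noteq> p j"
      proof
        assume "p i = p j"
        then have "axis i 1 \<in> vec.span {axis j (1 :: complex)}"
          unfolding p_def using vec.span_base[of "axis i 1" "{axis i 1}"] by blast
        then obtain t where "axis i 1 = t *s axis j (1 :: complex)" by (auto simp: vec.span_singleton)
        from arg_cong[OF this, of "\<lambda>v. v $ i"] \<open>i \<noteq> j\<close> show False by (simp add: axis_def)
      qed
      then have "h' (p i) \<noteq> h' (p j)" using bspec[OF hh p[of i]] bspec[OF hh p[of j]] by metis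
      moreover have "h' (p i) \<in> fibre M (W\<^sub>1, W\<^sub>2)" "h' (p j) \<in> fibre M (W\<^sub>1, W\<^sub>2)"
        using h' p by auto
      moreover have "CARD('c) \<ge> 2" using assms by simp
      ultimately obtain f where "\<forall>a\<in>W\<^sub>1. \<forall>u\<in>W\<^sub>2. contraction M a u \<in> vec.span {f}"
        using two_points_rank_one[OF W] by blast
      from line_of_rank_one[OF nondeg W this] show ?line using assms(3) by simp
    qed
  qed
  show ?thesis using U(1,2) inj equiv unfolding big_def by blast
qed

end
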